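(* For every integer $k\ge1$, the friendship graph $F_k=K_1\vee kK_2$ is determined by its distance spectrum; that is, for any connected graph $H$, $\mathrm{Spec}_D(H)=\mathrm{Spec}_D(F_k)$ implies $H\cong F_k$.
   Context: All graphs are finite and simple. For a connected graph $G$ with vertices $v_1,\ldots,v_n$, the distance matrix is $D(G)=(d(v_i,v_j))_{n\times n}$, where $d(v_i,v_j)$ is the length of a shortest path; the distance spectrum $\mathrm{Spec}_D(G)$ is the multiset of eigenvalues of $D(G)$ (with multiplicities). $F_k$ consists of $k$ edge-disjoint triangles all meeting in one common vertex, i.e. it is the join $K_1\vee kK_2$ of a single vertex with the disjoint union of $k$ copies of $K_2$. *)

theory Defs
  imports "Graph_Theory.Graph_Theory" "Jordan_Normal_Form.Char_Poly"
begin

section \<open>Distance spectrum\<close>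

text \<open>
  A finite simple graph is a \<open>pair_graph\<close>: a finite loop-free symmetric digraph whose arcs are
  ordered pairs of vertices, each undirected edge being represented by two opposite arcs.
\<close>

definition graph_dist :: "'a pair_pre_digraph \<Rightarrow> 'a \<Rightarrow> 'a \<Rightarrow> nat" where
  "graph_dist G u v = (LEAST l. \<exists>p. pre_digraph.apath (with_proj G) u p v \<and> length p = l)"

definition dist_matrix :: "'a pair_pre_digraph \<Rightarrow> 'a list \<Rightarrow> complex mat" where
  "dist_matrix G vs =
     mat (length vs) (length vs) (\<lambda>(i, j). of_nat (graph_dist G (vs ! i) (vs ! j)))"

definition is_vertex_enum :: "'a pair_pre_digraph \<Rightarrow> 'a list \<Rightarrow> bool" where
  "is_vertex_enum G vs \<longleftrightarrow> distinct vs \<and> set vs = pverts G"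

text \<open>
  The matrix is taken over the complex numbers so that its characteristic polynomial splits and
  \<open>proots\<close> lists all eigenvalues with their multiplicities (they are real, and algebraic and
  geometric multiplicities agree, the matrix being real symmetric). The choice of the enumeration
  is immaterial, see \<open>dist_spectrum_eq\<close> below.
\<close>

definition dist_spectrum :: "'a pair_pre_digraph \<Rightarrow> complex multiset" where
  "dist_spectrum G = proots (char_poly (dist_matrix G (SOME vs. is_vertex_enum G vs)))"

lemma char_poly_permute:
  fixes A :: "'a :: idom mat"
  assumes A: "A \<in> carrier_mat n n" and p: "p permutes {0..<n}"
  shows "char_poly (mat n n (\<lambda>(i, j). A $$ (p i, p j))) = char_poly A"
proof -
  let ?C = "char_poly_matrix A"
  let ?R = "mat n n (\<lambda>(i, j). ?C $$ (p i, j))"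
  have C: "?C \<in> carrier_mat n n" using A by simp
  have pn: "p i < n" if "i < n" for i using permutes_in_image[OF p, of i] that by simp
  have pe: "p i = p j \<longleftrightarrow> i = j" for i j using permutes_inj[OF p] by (auto dest: injD)
  have eq: "char_poly_matrix (mat n n (\<lambda>(i, j). A $$ (p i, p j)))
      = transpose_mat (mat n n (\<lambda>(i, j). transpose_mat ?R $$ (p i, j)))"
    by (rule eq_matI) (use A pn pe in \<open>auto simp: char_poly_matrix_def\<close>)
  have "det (mat n n (\<lambda>(i, j). transpose_mat ?R $$ (p i, j))) = signof p * det (transpose_mat ?R)"
    by (rule det_permute_rows[OF _ p]) auto
  also have "det (transpose_mat ?R) = det ?R" by (rule det_transpose[of _ n]) auto
  also have "\<dots> = signof p * det ?C" by (rule det_permute_rows[OF C p])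
  also have "signof p * (signof p * det ?C) = det ?C" by (auto simp: sign_def)
  finally show ?thesis
    unfolding char_poly_def eq by (subst det_transpose[of _ n]) auto
qed

lemma dist_spectrum_eq:
  assumes vs: "is_vertex_enum G vs"
  shows "dist_spectrum G = proots (char_poly (dist_matrix G vs))"
proof -
  define ws where "ws = (SOME vs. is_vertex_enum G vs)"
  have ws: "is_vertex_enum G ws" unfolding ws_def using vs by (rule someI)
  have "mset ws = mset vs"
    using vs ws by (simp add: is_vertex_enum_def set_eq_iff_mset_eq_distinct[symmetric])
  then obtain p where p: "p permutes {..<length vs}" "permute_list p vs = ws"
    by (rule mset_eq_permutation)
  let ?n = "length vs"
  have p': "p permutes {0..<?n}" using p(1) by (simp add: atLeast0LessThan)
  have pn: "p i < ?n" if "i < ?n" for i using permutes_in_image[OF p', of i] that by simp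
  have "dist_matrix G ws = mat ?n ?n (\<lambda>(i, j). dist_matrix G vs $$ (p i, p j))"
    by (rule eq_matI)
      (use p pn in \<open>auto simp: dist_matrix_def permute_list_nth simp flip: p(2)\<close>)
  then have "char_poly (dist_matrix G ws) = char_poly (dist_matrix G vs)"
    by (simp add: char_poly_permute[OF _ p'] dist_matrix_def)
  then show ?thesis by (simp add: dist_spectrum_def ws_def)
qed


section \<open>The friendship graph\<close>

definition complete_graph :: "nat \<Rightarrow> nat pair_pre_digraph" where
  "complete_graph n = \<lparr> pverts = {..<n}, parcs = {(u, v). u < n \<and> v < n \<and> u \<noteq> v} \<rparr>"

definition graph_copies :: "nat \<Rightarrow> 'a pair_pre_digraph \<Rightarrow> (nat \<times> 'a) pair_pre_digraph" where
  "graph_copies k G =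
     \<lparr> pverts = {..<k} \<times> pverts G,
       parcs = {((i, u), (i, v)) | i u v. i < k \<and> (u, v) \<in> parcs G} \<rparr>"

definition graph_join ::
  "'a pair_pre_digraph \<Rightarrow> 'b pair_pre_digraph \<Rightarrow> ('a + 'b) pair_pre_digraph" where
  "graph_join G H =
     \<lparr> pverts = pverts G <+> pverts H,
       parcs = map_prod Inl Inl ` parcs G \<union> map_prod Inr Inr ` parcs H
         \<union> (Inl ` pverts G) \<times> (Inr ` pverts H) \<union> (Inr ` pverts H) \<times> (Inl ` pverts G) \<rparr>"

definition friendship_graph :: "nat \<Rightarrow> (nat + nat \<times> nat) pair_pre_digraph" where
  "friendship_graph k = graph_join (complete_graph 1) (graph_copies k (complete_graph 2))"

lemma pair_graph_friendship_graph: "pair_graph (friendship_graph k)"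
proof -
  let ?G = "friendship_graph k"
  have fin: "finite (pverts ?G)"
    by (auto simp: friendship_graph_def graph_join_def graph_copies_def complete_graph_def)
  have wf: "parcs ?G \<subseteq> pverts ?G \<times> pverts ?G"
    by (auto simp: friendship_graph_def graph_join_def graph_copies_def complete_graph_def)
  have "finite (parcs ?G)" using wf fin by (meson finite_SigmaI finite_subset)
  moreover have "symmetric (with_proj ?G)"
    unfolding symmetric_def with_proj_simps
    by (rule symI)
      (auto simp: friendship_graph_def graph_join_def graph_copies_def complete_graph_def)
  moreover have "fst e \<noteq> snd e" if "e \<in> parcs ?G" for e
    using that
    by (auto simp: friendship_graph_def graph_join_def graph_copies_def complete_graph_def)
  ultimately show ?thesis
    using fin wf by unfold_locales auto
qed

end

theory Submission
  imports Defs "Jordan_Normal_Form.Schur_Decomposition" "HOL-Analysis.Convex"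
begin

text \<open>
  The distance eigenvalues of \<open>F\<^sub>k\<close> are real, at least \<open>-3\<close> and different from \<open>-2\<close>. If \<open>H\<close> has the
  same spectrum, then \<open>D(H) + 3I\<close> is positive semidefinite, so \<open>H\<close> has no geodesic of length 3:
  the vector \<open>(2, 1, -1, -2)\<close> on its vertices would be a negative direction. Hence \<open>H\<close> has diameter
  at most 2 and \<open>D(H) = 2J - 2I - A\<close>, and the traces of \<open>D(H)\<^sup>2\<close> and \<open>D(H)\<^sup>3\<close> determine the degree
  sum \<open>6k\<close> and the value \<open>24k\<^sup>2 + 42k\<close> of \<open>6 \<Sum> deg(v)\<^sup>2 - tr A\<^sup>3\<close>.

  Without a dominating vertex all degrees lie between \<open>2\<close> and \<open>2k - 1\<close>, and given the degree sum
  \<open>\<Sum> deg(v)\<^sup>2\<close> is then too small, except for \<open>k = 2\<close> and \<open>H = K\<^bsub>2,3\<^esub>\<close>; there, nonadjacent twins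
  produce the eigenvalue \<open>-2\<close>. With a dominating vertex, bounding the number of triangles through a
  vertex by its degree forces every other degree to be 2, that is, \<open>H\<close> is \<open>F\<^sub>k\<close>.
\<close>

section \<open>Traces and quadratic forms of matrices\<close>

lemma upper_triangular_mult:
  fixes A B :: "'a :: semiring_0 mat"
  assumes A: "A \<in> carrier_mat n n" "upper_triangular A"
    and B: "B \<in> carrier_mat n n" "upper_triangular B"
  shows "upper_triangular (A * B)"
    and "\<And>i. i < n \<Longrightarrow> (A * B) $$ (i, i) = A $$ (i, i) * B $$ (i, i)"
proof -
  have prod: "(A * B) $$ (i, j) = (\<Sum>l = 0..<n. A $$ (i, l) * B $$ (l, j))" if "i < n" "j < n" for i j
    using A B that by (simp add: scalar_prod_def)
  show "upper_triangular (A * B)"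
  proof
    fix i j assume "j < i" "i < dim_row (A * B)"
    then have ij: "j < i" "i < n" using A by auto
    have "A $$ (i, l) * B $$ (l, j) = 0" if "l < n" for l
      using ij that A B by (cases "l < i") (auto simp: upper_triangular_def)
    then show "(A * B) $$ (i, j) = 0" using ij by (simp add: prod)
  qed
  fix i assume i: "i < n"
  have "(\<Sum>l\<in>{0..<n} - {i}. A $$ (i, l) * B $$ (l, i)) = 0"
    using i A B by (intro sum.neutral ballI) (metis DiffD1 DiffD2 atLeastLessThan_iff carrier_matD(1)
        insertI1 linorder_neqE_nat mult_zero_left mult_zero_right singletonI upper_triangularD)
  then show "(A * B) $$ (i, i) = A $$ (i, i) * B $$ (i, i)"
    using i by (simp add: prod sum.remove[of "{0..<n}" i])
qed

lemma upper_triangular_pow: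
  fixes A :: "'a :: semiring_1 mat"
  assumes "A \<in> carrier_mat n n" "upper_triangular A"
  shows "upper_triangular (A ^\<^sub>m m) \<and> (\<forall>i < n. (A ^\<^sub>m m) $$ (i, i) = (A $$ (i, i)) ^ m)"
proof (induction m)
  case 0
  then show ?case using assms by auto
next
  case (Suc m)
  then show ?case
    using upper_triangular_mult[of "A ^\<^sub>m m" n A] assms by (simp add: power_commutes)
qed

definition mat_trace :: "'a :: comm_monoid_add mat \<Rightarrow> 'a" where
  "mat_trace A = (\<Sum>i<dim_row A. A $$ (i, i))"

lemma mat_trace_mult:
  fixes A B :: "'a :: semiring_0 mat"
  assumes "A \<in> carrier_mat n m" "B \<in> carrier_mat m n"
  shows "mat_trace (A * B) = (\<Sum>i<n. \<Sum>j<m. A $$ (i, j) * B $$ (j, i))"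
  using assms by (simp add: mat_trace_def scalar_prod_def atLeast0LessThan)

lemma mat_trace_mult_comm:
  fixes A B :: "'a :: comm_semiring_0 mat"
  assumes "A \<in> carrier_mat n m" "B \<in> carrier_mat m n"
  shows "mat_trace (A * B) = mat_trace (B * A)"
  unfolding mat_trace_mult[OF assms] mat_trace_mult[OF assms(2,1)]
  by (subst sum.swap) (simp add: mult.commute)

lemma mat_trace_similar:
  fixes A B :: "'a :: comm_ring_1 mat"
  assumes A: "A \<in> carrier_mat n n" and sim: "similar_mat_wit A B P Q"
  shows "mat_trace A = mat_trace B"
proof -
  note d = similar_mat_witD2[OF A sim]
  have "mat_trace A = mat_trace ((P * B) * Q)" using d by simp
  also have "\<dots> = mat_trace (Q * (P * B))" using d by (intro mat_trace_mult_comm) auto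
  also have "Q * (P * B) = B" using d by (simp flip: assoc_mult_mat[of Q n n P n B n])
  finally show ?thesis .
qed

lemma proots_prod_linear_factors:
  fixes es :: "'a :: idom list"
  shows "proots (\<Prod>e\<leftarrow>es. [:- e, 1:]) = mset es"
proof (induction es)
  case (Cons e es)
  have "(\<Prod>e\<leftarrow>es. [:- e, 1:]) \<noteq> 0" by (auto simp: prod_list_zero_iff)
  then show ?case using Cons by (simp add: proots_mult del: mult_pCons_left)
qed simp

text \<open>Schur decomposition makes \<open>A\<close> similar to an upper triangular matrix whose
  diagonal lists the roots of the characteristic polynomial. Powers keep this shape and act
  entrywise on the diagonal, and the trace is invariant under similarity.\<close>

lemma mat_trace_pow_eq_sum_roots:
  fixes A :: "complex mat"
  assumes A: "A \<in> carrier_mat n n"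
  shows "mat_trace (A ^\<^sub>m m) = (\<Sum>e\<in>#proots (char_poly A). e ^ m)"
proof -
  obtain es where es: "char_poly A = (\<Prod>e\<leftarrow>es. [:- e, 1:])" "length es = n"
    using char_poly_factorized[OF A] by blast
  obtain B P Q where "schur_decomposition A es = (B, P, Q)" by (metis prod_cases3)
  from schur_decomposition[OF A es(1) this]
  have sim: "similar_mat_wit A B P Q" and B: "upper_triangular B" "diag_mat B = es" by auto
  have Bn: "B \<in> carrier_mat n n" using similar_mat_witD2[OF A sim] by auto
  have "mat_trace (A ^\<^sub>m m) = mat_trace (B ^\<^sub>m m)"
    by (rule mat_trace_similar[OF _ similar_mat_wit_pow[OF sim]]) (use A in auto)
  also have "\<dots> = (\<Sum>i<n. (B $$ (i, i)) ^ m)"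
    using upper_triangular_pow[OF Bn B(1), of m] Bn by (simp add: mat_trace_def)
  also have "\<dots> = (\<Sum>e\<leftarrow>es. e ^ m)"
    using Bn by (simp flip: B(2) add: diag_mat_def sum_list_sum_nth o_def atLeast0LessThan)
  also have "\<dots> = (\<Sum>e\<in>#mset es. e ^ m)" by (simp flip: sum_mset_sum_list)
  also have "mset es = proots (char_poly A)"
    unfolding es(1) by (rule proots_prod_linear_factors[symmetric])
  finally show ?thesis .
qed


section \<open>Quadratic forms of symmetric matrices and their eigenvalues\<close>

lemma pow_mat_add:
  fixes A :: "'a :: semiring_1 mat"
  assumes A: "A \<in> carrier_mat n n"
  shows "A ^\<^sub>m (m + l) = A ^\<^sub>m m * A ^\<^sub>m l"
proof (induction l)
  case 0
  then show ?case using A by simp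
next
  case (Suc l)
  then show ?case
    using A by (simp add: assoc_mult_mat[of _ n n _ n _ n])
qed

lemma transpose_pow_mat:
  fixes A :: "'a :: comm_semiring_1 mat"
  assumes A: "A \<in> carrier_mat n n"
  shows "transpose_mat (A ^\<^sub>m m) = transpose_mat A ^\<^sub>m m"
proof (induction m)
  case 0
  then show ?case using A by simp
next
  case (Suc m)
  have "transpose_mat (A ^\<^sub>m Suc m) = transpose_mat A ^\<^sub>m 1 * transpose_mat A ^\<^sub>m m"
    using A Suc by (simp add: transpose_mult[of _ n n _ n])
  also have "\<dots> = transpose_mat A ^\<^sub>m Suc m"
    by (subst pow_mat_add[symmetric, of _ n]) (use A in auto)
  finally show ?case .
qed

definition quad_form :: "real mat \<Rightarrow> (nat \<Rightarrow> real) \<Rightarrow> real" where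
  "quad_form A x = (\<Sum>i<dim_row A. \<Sum>j<dim_col A. A $$ (i, j) * x i * x j)"

text \<open>For y = Bx the form of \<open>B * B\<close> is |y|^2 by symmetry, and the form of
  \<open>B\<close> is the inner product of x and y. Both bounds are Cauchy-Schwarz: once for x and
  y, once for each row of \<open>B\<close> and x, where \<open>mat_trace (B * B)\<close> is the sum
  of the squared entries of \<open>B\<close>.\<close>

lemma quad_form_square:
  fixes B :: "real mat" and x :: "nat \<Rightarrow> real"
  assumes B: "B \<in> carrier_mat n n" and sym: "transpose_mat B = B"
  defines "X \<equiv> \<Sum>i<n. (x i)\<^sup>2"
  shows "(quad_form B x)\<^sup>2 \<le> X * quad_form (B * B) x"
    and "quad_form (B * B) x \<le> X * mat_trace (B * B)"
proof -
  define y where "y l = (\<Sum>j<n. B $$ (l, j) * x j)" for l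
  have Bsym: "B $$ (i, j) = B $$ (j, i)" if "i < n" "j < n" for i j
    using B that sym by (metis carrier_matD index_transpose_mat(1))
  have "quad_form (B * B) x = (\<Sum>i<n. \<Sum>j<n. \<Sum>l<n. (B $$ (i, l) * x i) * (B $$ (l, j) * x j))"
    using B by (simp add: quad_form_def scalar_prod_def atLeast0LessThan sum_distrib_left sum_distrib_right mult_ac)
  also have "\<dots> = (\<Sum>i<n. \<Sum>l<n. \<Sum>j<n. (B $$ (i, l) * x i) * (B $$ (l, j) * x j))"
    by (subst (2) sum.swap) simp
  also have "\<dots> = (\<Sum>l<n. \<Sum>i<n. \<Sum>j<n. (B $$ (i, l) * x i) * (B $$ (l, j) * x j))"
    by (rule sum.swap)
  also have "\<dots> = (\<Sum>l<n. \<Sum>i<n. (B $$ (i, l) * x i) * y l)"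
    by (simp add: y_def sum_distrib_left)
  also have "\<dots> = (\<Sum>l<n. (y l)\<^sup>2)"
  proof (rule sum.cong)
    fix l assume "l \<in> {..<n}"
    then have "(\<Sum>i<n. B $$ (i, l) * x i) = y l" by (simp add: y_def Bsym)
    then show "(\<Sum>i<n. (B $$ (i, l) * x i) * y l) = (y l)\<^sup>2"
      by (simp add: power2_eq_square flip: sum_distrib_right)
  qed simp
  finally have qBB: "quad_form (B * B) x = (\<Sum>l<n. (y l)\<^sup>2)" .
  have "quad_form B x = (\<Sum>i<n. x i * y i)"
    using B by (simp add: quad_form_def y_def sum_distrib_left mult_ac)
  then show "(quad_form B x)\<^sup>2 \<le> X * quad_form (B * B) x"
    unfolding qBB X_def using Cauchy_Schwarz_ineq_sum[of x y "{..<n}"] by simp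
  have "(y l)\<^sup>2 \<le> (\<Sum>j<n. (B $$ (l, j))\<^sup>2) * X" for l
    unfolding y_def X_def by (rule Cauchy_Schwarz_ineq_sum)
  then have "quad_form (B * B) x \<le> (\<Sum>l<n. (\<Sum>j<n. (B $$ (l, j))\<^sup>2) * X)"
    unfolding qBB by (rule sum_mono)
  also have "\<dots> = X * mat_trace (B * B)"
    by (subst mat_trace_mult[OF B B])
      (auto simp: sum_distrib_left sum_distrib_right Bsym power2_eq_square mult_ac
        intro!: sum.cong)
  finally show "quad_form (B * B) x \<le> X * mat_trace (B * B)" .
qed

lemma norm_sum_mset_le:
  fixes f :: "'a \<Rightarrow> 'b :: real_normed_vector" and b :: real
  assumes "\<And>e. e \<in># M \<Longrightarrow> norm (f e) \<le> b"
  shows "norm (\<Sum>e\<in>#M. f e) \<le> real (size M) * b"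
  using assms
proof (induction M)
  case (add e M)
  have "norm (\<Sum>e\<in>#add_mset e M. f e) \<le> norm (f e) + norm (\<Sum>e\<in>#M. f e)"
    by (simp add: norm_triangle_ineq)
  also have "\<dots> \<le> b + real (size M) * b" using add by (intro add_mono) auto
  finally show ?case by (simp add: algebra_simps)
qed simp

text \<open>
  Instead of the spectral theorem: if \<open>x\<^sup>T A x > c |x|\<^sup>2\<close>, then by Cauchy-Schwarz the forms of
  \<open>A\<close>, \<open>A\<^sup>2\<close>, \<open>A\<^sup>4\<close>, \<dots> at \<open>x\<close> grow like powers of a number above \<open>c\<close>, whereas they are bounded by
  traces, which grow at most like powers of \<open>c\<close>.
\<close>
lemma quad_form_le_of_eigenvalues_le:
  fixes A :: "real mat"
  assumes A: "A \<in> carrier_mat n n" and sym: "transpose_mat A = A"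
    and ev: "\<And>e. e \<in># proots (char_poly (map_mat complex_of_real A)) \<Longrightarrow> cmod e \<le> c"
  shows "quad_form A x \<le> c * (\<Sum>i<n. (x i)\<^sup>2)"
proof (cases "(\<Sum>i<n. (x i)\<^sup>2) = 0")
  case True
  then have "x i = 0" if "i < n" for i using that by (simp add: sum_nonneg_eq_0_iff)
  then show ?thesis using A True by (simp add: quad_form_def)
next
  case False
  define X where "X = (\<Sum>i<n. (x i)\<^sup>2)"
  have X: "X > 0" using False unfolding X_def by (simp add: order_less_le sum_nonneg)
  let ?M = "proots (char_poly (map_mat complex_of_real A))"
  have size: "size ?M = n"
    using degree_monic_char_poly[of "map_mat complex_of_real A" n] A by (simp add: size_proots_complex)
  \<comment> \<open>The assumption on eigenvalues forces \<open>c\<close> to be nonnegative only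
    once an eigenvalue exists.\<close>
  have "n \<noteq> 0" using False by (cases n) auto
  then obtain e where "e \<in># ?M" using size by (metis multiset_nonemptyE size_empty)
  then have c: "c \<ge> 0" using ev[of e] norm_ge_zero[of e] by linarith
  show ?thesis
  proof (rule ccontr)
    assume "\<not> ?thesis"
    then have less: "c * X < quad_form A x" by (simp add: X_def)
    \<comment> \<open>The Rayleigh quotient of \<open>x\<close>, to be compared with
      \<open>c\<close> by repeated squaring of \<open>A\<close>.\<close>
    define r where "r = quad_form A x / X"
    have r: "r > c" using less X by (simp add: r_def field_simps)
    define B where "B j = A ^\<^sub>m (2 ^ j)" for j :: nat
    have Bn: "B j \<in> carrier_mat n n" for j using A by (simp add: B_def)
    have Bsym: "transpose_mat (B j) = B j" for j
      unfolding B_def transpose_pow_mat[OF A] sym ..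
    have BSuc: "B (Suc j) = B j * B j" for j
      unfolding B_def by (simp add: mult_2 pow_mat_add[OF A])
    have lower: "X * r ^ 2 ^ j \<le> quad_form (B j) x" for j
    proof (induction j)
      case 0
      then show ?case using X A by (simp add: B_def r_def)
    next
      case (Suc j)
      have "0 \<le> X * r ^ 2 ^ j" using X r c by simp
      then have "(X * r ^ 2 ^ j)\<^sup>2 \<le> (quad_form (B j) x)\<^sup>2"
        using Suc by (rule power_mono[rotated])
      also have "\<dots> \<le> X * quad_form (B (Suc j)) x"
        using quad_form_square(1)[OF Bn Bsym] by (simp add: BSuc X_def)
      finally have "X * (X * r ^ 2 ^ Suc j) \<le> X * quad_form (B (Suc j)) x"
        by (simp add: power2_eq_square power_mult_distrib mult_ac mult_2 power_add)
      then show ?case using X by simp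
    qed
    have trace: "mat_trace (A ^\<^sub>m m) \<le> n * c ^ m" for m
    proof -
      have "complex_of_real (mat_trace (A ^\<^sub>m m)) = mat_trace (map_mat complex_of_real A ^\<^sub>m m)"
        using A by (simp add: mat_trace_def flip: of_real_hom.mat_hom_pow[OF A])
      also have "\<dots> = (\<Sum>e\<in>#?M. e ^ m)" by (rule mat_trace_pow_eq_sum_roots) (use A in simp)
      finally have "\<bar>mat_trace (A ^\<^sub>m m)\<bar> = cmod (\<Sum>e\<in>#?M. e ^ m)"
        by (metis norm_of_real real_norm_def)
      also have "\<dots> \<le> real (size ?M) * c ^ m"
        using ev by (intro norm_sum_mset_le) (simp add: norm_power power_mono)
      finally show ?thesis using size by simp
    qed
    have bound: "r ^ 2 ^ Suc j \<le> n * c ^ 2 ^ Suc j" for j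
    proof -
      have "X * r ^ 2 ^ Suc j \<le> X * mat_trace (B (Suc j))"
        using lower[of "Suc j"] quad_form_square(2)[OF Bn Bsym, of j x] by (simp add: BSuc X_def)
      then have "r ^ 2 ^ Suc j \<le> mat_trace (B (Suc j))" using X by simp
      also have "\<dots> \<le> n * c ^ 2 ^ Suc j" unfolding B_def by (rule trace)
      finally show ?thesis .
    qed
    \<comment> \<open>If \<open>c\<close> were 0, the bound at \<open>j = 0\<close> would make the
      square of \<open>r\<close> nonpositive, against \<open>r > c\<close>.\<close>
    have "c > 0"
    proof (rule ccontr)
      assume "\<not> c > 0"
      then show False using bound[of 0] c r by (simp add: not_less zero_less_power)
    qed
    then have "r / c > 1" using r by simp
    \<comment> \<open>Powers of \<open>r / c\<close> are unbounded, but by \<open>bound\<close>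
      those with exponent \<open>2 ^ Suc j\<close> are at most \<open>n\<close>.\<close>
    then obtain N where N: "(r / c) ^ N > n" using real_arch_pow by blast
    have "N \<le> 2 ^ Suc N" by (metis less_exp order_less_imp_le order_trans le_SucI Suc_leD)
    then have "(r / c) ^ N \<le> (r / c) ^ 2 ^ Suc N" using \<open>r / c > 1\<close> by (intro power_increasing) auto
    also have "\<dots> \<le> n" using bound[of N] \<open>c > 0\<close> by (simp add: power_divide field_simps)
    finally show False using N by simp
  qed
qed

section \<open>Moment conditions on a graph of diameter at most 2\<close>

locale fin_graph =
  fixes V :: "'a set" and E :: "'a \<Rightarrow> 'a \<Rightarrow> bool"
  assumes finite_V: "finite V"
    and sym: "E u v \<Longrightarrow> E v u"
    and irrefl: "\<not> E u u"
    and E_V: "E u v \<Longrightarrow> u \<in> V"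
begin

definition nb :: "'a \<Rightarrow> 'a set" where "nb u = {v. E u v}"

definition deg :: "'a \<Rightarrow> nat" where "deg u = card (nb u)"

text \<open>This counts ordered triples of mutually adjacent vertices: six times the number of
  triangles, or the trace of the cube of the adjacency matrix.\<close>

definition triangles :: nat where
  "triangles = (\<Sum>u\<in>V. \<Sum>v\<in>nb u. card (nb u \<inter> nb v))"

definition diam_le_2 :: bool where
  "diam_le_2 \<longleftrightarrow> (\<forall>u\<in>V. \<forall>v\<in>V. u \<noteq> v \<longrightarrow> \<not> E u v \<longrightarrow> nb u \<inter> nb v \<noteq> {})"

lemma mem_nb: "v \<in> nb u \<longleftrightarrow> E u v" by (simp add: nb_def)

lemma nb_commute: "v \<in> nb u \<longleftrightarrow> u \<in> nb v"
  using sym by (auto simp: nb_def)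

lemma nb_subset: "nb u \<subseteq> V - {u}"
  using E_V sym irrefl by (auto simp: nb_def)

lemma finite_nb: "finite (nb u)"
  using finite_subset[OF nb_subset] finite_V by blast

lemma deg_le: "u \<in> V \<Longrightarrow> deg u \<le> card V - 1"
  unfolding deg_def using card_mono[OF _ nb_subset, of u] finite_V by simp

lemma nb_eq_if_deg_max:
  assumes "u \<in> V" "deg u = card V - 1"
  shows "nb u = V - {u}"
  using assms finite_V by (intro card_subset_eq nb_subset) (auto simp: deg_def)

lemma card_common_nb_le: "v \<in> nb u \<Longrightarrow> card (nb u \<inter> nb v) \<le> deg u - 1"
proof -
  assume v: "v \<in> nb u"
  have "nb u \<inter> nb v \<subseteq> nb u - {v}" using irrefl by (auto simp: nb_def)
  then have "card (nb u \<inter> nb v) \<le> card (nb u - {v})" by (intro card_mono) (simp_all add: finite_nb)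
  then show ?thesis using v by (simp add: deg_def)
qed

text \<open>Off the centre let \<open>e u = deg u - 1\<close>. These 2k numbers have sum 2k.
  Counting triangles exactly at the centre and bounding them by degrees elsewhere turns the moment
  identity into 5S \<le> 10k for the sum S of their squares. Hence their total squared deviation
  from 1 is zero.\<close>

lemma all_deg_2_if_dominating:
  assumes card: "card V = 2 * k + 1" and sum: "(\<Sum>u\<in>V. deg u) = 6 * k"
    and moment: "6 * (\<Sum>u\<in>V. (deg u)\<^sup>2) = triangles + 24 * k\<^sup>2 + 42 * k"
    and c: "c \<in> V" "nb c = V - {c}" and u: "u \<in> V" "u \<noteq> c"
  shows "deg u = 2"
proof -
  define W where "W = V - {c}"
  have W: "finite W" "card W = 2 * k" using card c finite_V by (auto simp: W_def)
  have split: "(\<Sum>u\<in>V. f u) = f c + (\<Sum>u\<in>W. f u)" for f :: "'a \<Rightarrow> nat"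
    unfolding W_def using c finite_V by (simp add: sum.remove)
  have degc: "deg c = 2 * k" using W c by (simp add: deg_def W_def)
  have deg_pos: "deg u \<ge> 1" if "u \<in> W" for u
  proof -
    have "c \<in> nb u" using that c by (simp add: W_def nb_commute[of c])
    then show ?thesis unfolding deg_def using finite_nb[of u] by (metis card_0_eq empty_iff less_one not_le)
  qed
  define e where "e u = deg u - 1" for u
  have deg: "deg u = e u + 1" if "u \<in> W" for u using deg_pos[OF that] by (simp add: e_def)
  have "(\<Sum>u\<in>W. deg u) = 4 * k" using sum degc by (simp add: split)
  moreover have "(\<Sum>u\<in>W. deg u) = (\<Sum>u\<in>W. e u) + 2 * k"
    using W by (simp add: deg sum_Suc)
  ultimately have sum_e: "(\<Sum>u\<in>W. e u) = 2 * k" by simp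
  \<comment> \<open>Triangles at the centre: every neighbour of \<open>v\<close> other than
    \<open>c\<close> is also a neighbour of \<open>c\<close>.\<close>
  have "(\<Sum>v\<in>nb c. card (nb c \<inter> nb v)) = (\<Sum>v\<in>W. e v)"
  proof (rule sum.cong)
    fix v assume v: "v \<in> W"
    have "c \<in> nb v" using v c by (simp add: W_def nb_commute[of c])
    moreover have "nb c \<inter> nb v = nb v - {c}"
      using nb_subset[of v] c by auto
    ultimately show "card (nb c \<inter> nb v) = e v" by (simp add: e_def deg_def card_Diff_singleton)
  qed (use c in \<open>simp add: W_def\<close>)
  \<comment> \<open>Each of the \<open>e u + 1\<close> neighbours of \<open>u\<close> shares at most
    \<open>e u\<close> neighbours with it.\<close>
  moreover have "(\<Sum>v\<in>nb u. card (nb u \<inter> nb v)) \<le> (e u)\<^sup>2 + e u" if "u \<in> W" for u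
  proof -
    have "(\<Sum>v\<in>nb u. card (nb u \<inter> nb v)) \<le> (\<Sum>v\<in>nb u. e u)"
      unfolding e_def by (intro sum_mono card_common_nb_le)
    also have "\<dots> = (e u)\<^sup>2 + e u"
      using deg[OF that] by (simp add: deg_def power2_eq_square)
    finally show ?thesis .
  qed
  ultimately have "triangles \<le> (\<Sum>v\<in>W. e v) + (\<Sum>u\<in>W. (e u)\<^sup>2 + e u)"
    unfolding triangles_def split by (intro add_mono sum_mono) auto
  then have tri: "triangles \<le> 4 * k + (\<Sum>u\<in>W. (e u)\<^sup>2)"
    using sum_e by (simp add: sum.distrib)
  have "(\<Sum>u\<in>W. (deg u)\<^sup>2) = (\<Sum>u\<in>W. (e u)\<^sup>2 + 2 * e u + 1)"
    by (intro sum.cong) (simp_all add: deg power2_eq_square algebra_simps)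
  also have "\<dots> = (\<Sum>u\<in>W. (e u)\<^sup>2) + 6 * k"
    using W sum_e by (simp add: sum.distrib sum_Suc flip: sum_distrib_left)
  finally have "(\<Sum>u\<in>V. (deg u)\<^sup>2) = 4 * k\<^sup>2 + (\<Sum>u\<in>W. (e u)\<^sup>2) + 6 * k"
    unfolding split degc by (simp add: power_mult_distrib)
  with moment tri have le: "(\<Sum>u\<in>W. (e u)\<^sup>2) \<le> 2 * k" by simp
  \<comment> \<open>In the integers, since \<open>e u - 1\<close> may be negative.\<close>
  have "(\<Sum>u\<in>W. (int (e u) - 1)\<^sup>2) = (\<Sum>u\<in>W. int ((e u)\<^sup>2) - 2 * int (e u) + 1)"
    by (intro sum.cong) (simp_all add: power2_eq_square algebra_simps)
  also have "\<dots> = int (\<Sum>u\<in>W. (e u)\<^sup>2) - 2 * int (\<Sum>u\<in>W. e u) + int (card W)"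
    by (simp add: sum.distrib sum_subtractf sum_distrib_left)
  also have "\<dots> \<le> 0" using le sum_e W by linarith
  finally have "(\<Sum>u\<in>W. (int (e u) - 1)\<^sup>2) = 0" by (simp add: sum_nonneg order_antisym)
  then have "(int (e u) - 1)\<^sup>2 = 0" using W u by (simp add: sum_nonneg_eq_0_iff W_def)
  then show ?thesis using deg[of u] u by (simp add: W_def)
qed

text \<open>Otherwise all degrees lie between 2 and 2k - 1, and the excesses
  \<open>f u = deg u - 2\<close> sum to 2k - 2. Bounding one factor of each squared excess by 2k -
  3, the moment identity yields \<open>triangles\<close> \<le> 12 - 6k. Only a triangle-free graph
  with k = 2 remains; it is K_{2,3}, which \<open>twins\<close> excludes.\<close>

lemma ex_dominating:
  assumes card: "card V = 2 * k + 1" and k: "k \<ge> 1" and sum: "(\<Sum>u\<in>V. deg u) = 6 * k"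
    and moment: "6 * (\<Sum>u\<in>V. (deg u)\<^sup>2) = triangles + 24 * k\<^sup>2 + 42 * k"
    and diam: diam_le_2
    and twins: "\<And>u v. u \<in> V \<Longrightarrow> v \<in> V \<Longrightarrow> u \<noteq> v \<Longrightarrow> nb u \<noteq> nb v"
  shows "\<exists>c\<in>V. nb c = V - {c}"
proof (rule ccontr)
  assume no: "\<not> ?thesis"
  note diam = diam[unfolded diam_le_2_def, rule_format]
  have less: "deg u \<le> 2 * k - 1" if "u \<in> V" for u
    using deg_le[OF that] nb_eq_if_deg_max[OF that] no that card k by force
  have ge: "deg u \<ge> 2" if u: "u \<in> V" for u
  proof (rule ccontr)
    assume "\<not> deg u \<ge> 2"
    then have "card (nb u) \<le> 1" by (simp add: deg_def)
    then consider "nb u = {}" | c where "nb u = {c}"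
      using finite_nb[of u] by (cases "card (nb u) = 0") (auto simp: le_Suc_eq card_1_singleton_iff)
    then show False
    proof cases
      case 1
      have "card (V - {u}) \<noteq> 0" using card k u by simp
      then have "V - {u} \<noteq> {}" by (metis card.empty)
      then obtain v where "v \<in> V" "v \<noteq> u" by blast
      then show False using 1 diam[of u v] u by (auto simp: nb_def)
    next
      case 2
      \<comment> \<open>In diameter 2 the only neighbour of a vertex of degree 1 is adjacent to all
        other vertices.\<close>
      then have c: "c \<in> V" "E u c" using nb_subset by (auto simp: nb_def)
      have "v \<in> nb c" if "v \<in> V" "v \<noteq> c" for v
      proof (cases "v = u")
        case True
        then show ?thesis using c sym by (simp add: mem_nb)
      next
        case False
        have "\<not> E u v" using 2 that by (auto simp: nb_def)
        then have "nb u \<inter> nb v \<noteq> {}" using diam u that False by blast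
        then show ?thesis using 2 sym by (auto simp: nb_def)
      qed
      then have "nb c = V - {c}" using nb_subset by blast
      then show False using no c by blast
    qed
  qed
  define f where "f u = deg u - 2" for u
  have deg: "deg u = f u + 2" if "u \<in> V" for u using ge[OF that] by (simp add: f_def)
  have k2: "k \<ge> 2"
  proof (rule ccontr)
    assume "\<not> k \<ge> 2"
    then have "k = 1" using k by simp
    moreover obtain u where "u \<in> V" using card by fastforce
    \<comment> \<open>For k = 1 the degree bounds read 2 \<le> \<open>deg u\<close> \<le> 1.\<close>
    ultimately show False using less ge by fastforce
  qed
  have f: "f u \<le> 2 * k - 3" if "u \<in> V" for u using less[OF that] by (simp add: f_def)
  have "(\<Sum>u\<in>V. deg u) = (\<Sum>u\<in>V. f u) + 2 * card V" by (simp add: deg sum_Suc)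
  then have sum_f: "(\<Sum>u\<in>V. f u) = 2 * k - 2" using sum card by simp
  have "(\<Sum>u\<in>V. (f u)\<^sup>2) \<le> (\<Sum>u\<in>V. (2 * k - 3) * f u)"
    using f by (intro sum_mono) (simp add: power2_eq_square)
  then have sum_f2: "(\<Sum>u\<in>V. (f u)\<^sup>2) \<le> (2 * k - 3) * (2 * k - 2)"
    by (simp add: sum_f flip: sum_distrib_left)
  \<comment> \<open>Writing \<open>k = l + 2\<close> removes the truncated subtractions in
    \<open>2 * k - 3\<close> and \<open>2 * k - 2\<close>.\<close>
  obtain l where l: "k = l + 2" using k2 by (metis le_Suc_ex add.commute)
  have "(\<Sum>u\<in>V. (deg u)\<^sup>2) = (\<Sum>u\<in>V. (f u)\<^sup>2 + 4 * f u + 4)"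
    by (intro sum.cong) (simp_all add: deg power2_eq_square algebra_simps)
  also have "\<dots> = (\<Sum>u\<in>V. (f u)\<^sup>2) + 4 * (2 * k - 2) + 4 * card V"
    by (simp add: sum.distrib sum_f flip: sum_distrib_left)
  finally have eq: "triangles + 24 * k\<^sup>2 + 42 * k = 6 * (\<Sum>u\<in>V. (f u)\<^sup>2) + 24 * (2 * k - 2) + 24 * card V"
    using moment by simp
  then have "triangles + 6 * l \<le> 0"
    using sum_f2 unfolding card l by (simp add: power2_eq_square algebra_simps)
  then have k: "k = 2" and "triangles = 0" using l by auto
  then have no_tri: "nb u \<inter> nb v = {}" if "u \<in> V" "E u v" for u v
    using that finite_V finite_nb by (auto simp: triangles_def mem_nb)
  have "\<exists>u\<in>V. f u \<noteq> 0" 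
  proof (rule ccontr)
    assume "\<not> ?thesis"
    then show False using sum_f k by simp
  qed
  \<comment> \<open>Now there are five vertices, and the excesses sum to 2 and are at most 1. So
    some degree is 3, leaving exactly one nonneighbour.\<close>
  then obtain u where u: "u \<in> V" "deg u = 3" using less k by (fastforce simp: f_def)
  then have "card (V - {u} - nb u) = 1"
    using card k finite_V finite_nb nb_subset[of u] by (simp add: card_Diff_subset deg_def)
  then obtain w where w: "V - {u} - nb u = {w}" by (metis card_1_singletonE)
  \<comment> \<open>Without triangles a neighbour of \<open>u\<close> can only be adjacent to
    \<open>u\<close> and \<open>w\<close>, and its degree is at least 2.\<close>
  have nbv: "nb v = {u, w}" if v: "E u v" for v
  proof -
    have vV: "v \<in> V" using v sym E_V by blast
    have "nb v \<subseteq> {u, w}" using no_tri[OF u(1) v] nb_subset[of v] w by blast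
    moreover have "card {u, w} \<le> card (nb v)"
      using ge[OF vV] by (simp add: deg_def card_insert_if)
    ultimately show ?thesis by (intro card_seteq) auto
  qed
  have "nb w = nb u"
  proof
    show "nb u \<subseteq> nb w"
    proof
      fix x assume "x \<in> nb u"
      then have "w \<in> nb x" using nbv by (simp add: mem_nb)
      then show "x \<in> nb w" by (simp add: nb_commute[of x])
    qed
    have "w \<notin> nb u" using w by blast
    then have "u \<notin> nb w" by (simp add: nb_commute[of u])
    then show "nb w \<subseteq> nb u" using w nb_subset[of w] by blast
  qed
  then show False using twins[of u w] u w by blast
qed

end

section \<open>Traces of the square and the cube of 2J - 2I - A\<close>

context fin_graph
begin

text \<open>The entries of 2J - 2I - A, with J the all-ones matrix and A the adjacency matrix. They
  make sense for every graph and are its distances when the diameter is at most 2.\<close>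

definition diam2_dist :: "'a \<Rightarrow> 'a \<Rightarrow> nat" where
  "diam2_dist u v = (if u = v then 0 else if E u v then 1 else 2)"

text \<open>I and A enter sums as \<open>of_bool\<close> factors on the left; this and
  \<open>sum_adj\<close> evaluate such sums by rewriting.\<close>

lemma sum_delta:
  fixes f :: "'a \<Rightarrow> 'b :: semiring_1"
  assumes "u \<in> V"
  shows "(\<Sum>v\<in>V. of_bool (u = v) * f v) = f u"
  using assms finite_V by (simp add: of_bool_def if_distrib[of "\<lambda>x. x * _"] cong: if_cong)

lemma sum_adj:
  fixes f :: "'a \<Rightarrow> int"
  shows "(\<Sum>v\<in>V. of_bool (E u v) * f v) = (\<Sum>v\<in>nb u. f v)"
proof -
  have "(\<Sum>v\<in>V. of_bool (E u v) * f v) = (\<Sum>v\<in>nb u. of_bool (E u v) * f v)"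
    using nb_subset finite_V by (intro sum.mono_neutral_right) (auto simp: mem_nb)
  then show ?thesis by (simp add: mem_nb)
qed

lemma sum_adj_1: "(\<Sum>v\<in>V. of_bool (E u v)) = int (deg u)"
  using sum_adj[of u "\<lambda>_. 1"] by (simp add: deg_def)

text \<open>After exchanging the sums, each \<open>v\<close> is counted once for each of its
  neighbours.\<close>

lemma sum_sum_nb:
  fixes f :: "'a \<Rightarrow> int"
  shows "(\<Sum>u\<in>V. \<Sum>v\<in>nb u. f v) = (\<Sum>v\<in>V. int (deg v) * f v)"
proof -
  have "(\<Sum>u\<in>V. \<Sum>v\<in>nb u. f v) = (\<Sum>v\<in>V. \<Sum>u\<in>V. of_bool (E u v) * f v)"
    unfolding sum_adj[symmetric] by (rule sum.swap)
  also have "\<dots> = (\<Sum>v\<in>V. (\<Sum>u\<in>V. of_bool (E v u)) * f v)"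
    using nb_commute by (simp add: sum_distrib_right mem_nb)
  finally show ?thesis by (simp add: sum_adj_1)
qed

lemma diam2_dist_eq: "int (diam2_dist u v) = 2 - 2 * of_bool (u = v) - of_bool (E u v)"
  using irrefl by (auto simp: diam2_dist_def)

lemma diam2_dist_commute: "diam2_dist u v = diam2_dist v u"
  using nb_commute[of u v] by (auto simp: diam2_dist_def mem_nb)

lemma card_common_nb: "int (card (nb u \<inter> nb v)) = (\<Sum>w\<in>nb u. of_bool (E v w))"
  by (simp add: of_bool_def sum.If_cases finite_nb nb_def[of v])

text \<open>Both sides count walks of length 2 from \<open>u\<close>, by end vertex and by middle
  vertex.\<close>

lemma sum_card_common_nb: "(\<Sum>v\<in>V. int (card (nb u \<inter> nb v))) = (\<Sum>w\<in>nb u. int (deg w))"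
proof -
  have "(\<Sum>v\<in>V. int (card (nb u \<inter> nb v))) = (\<Sum>w\<in>nb u. \<Sum>v\<in>V. of_bool (E v w))"
    unfolding card_common_nb by (rule sum.swap)
  also have "\<dots> = (\<Sum>w\<in>nb u. \<Sum>v\<in>V. of_bool (E w v))"
    using nb_commute by (simp add: mem_nb)
  finally show ?thesis by (simp add: sum_adj_1)
qed

text \<open>The trace of D^2: squared entries are 4 off the diagonal, lowered by 3 at edges.\<close>

lemma sum_diam2_dist_2:
  "int (\<Sum>u\<in>V. \<Sum>v\<in>V. diam2_dist u v * diam2_dist v u)
    = 4 * (int (card V))\<^sup>2 - 4 * int (card V) - 3 * int (\<Sum>u\<in>V. deg u)"
proof -
  have "int (\<Sum>v\<in>V. diam2_dist u v * diam2_dist v u) = 4 * int (card V) - 4 - 3 * int (deg u)"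
    if u: "u \<in> V" for u
  proof -
    have "int (diam2_dist u v * diam2_dist v u) = 4 - of_bool (u = v) * 4 - of_bool (E u v) * 3" for v
      using irrefl nb_commute by (auto simp: diam2_dist_def mem_nb)
    then have "int (\<Sum>v\<in>V. diam2_dist u v * diam2_dist v u)
        = (\<Sum>v\<in>V. 4 - of_bool (u = v) * 4 - of_bool (E u v) * 3)"
      by simp
    also have "\<dots> = 4 * int (card V) - 4 - 3 * int (deg u)"
      unfolding sum_subtractf sum_delta[OF u] sum_adj by (simp add: deg_def)
    finally show ?thesis .
  qed
  then have "int (\<Sum>u\<in>V. \<Sum>v\<in>V. diam2_dist u v * diam2_dist v u)
      = (\<Sum>u\<in>V. 4 * int (card V) - 4 - 3 * int (deg u))"
    by simp
  also have "\<dots> = 4 * (int (card V))\<^sup>2 - 4 * int (card V) - 3 * int (\<Sum>u\<in>V. deg u)"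
    by (simp add: sum.distrib sum_subtractf sum_distrib_left power2_eq_square algebra_simps)
  finally show ?thesis .
qed

text \<open>The trace of D^3 for D = 2(J - I) - A. Here J - I alone contributes 8n(n - 1)(n - 2),
  the mixed products -12(n - 2)s and 6(q - s), and A alone the triangle term; s and q are the sums
  of the degrees and of their squares.\<close>

lemma sum_diam2_dist_3:
  defines "n \<equiv> int (card V)"
  shows "int (\<Sum>u\<in>V. \<Sum>v\<in>V. (\<Sum>w\<in>V. diam2_dist u w * diam2_dist w v) * diam2_dist v u)
    = 8 * n ^ 3 - 24 * n\<^sup>2 + 16 * n + (18 - 12 * n) * int (\<Sum>u\<in>V. deg u)
      + 6 * int (\<Sum>u\<in>V. (deg u)\<^sup>2) - int triangles"
proof -
  define c where "c u v = int (card (nb u \<inter> nb v))" for u v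
  define s where "s = (\<Sum>u\<in>V. int (deg u))"
  define q where "q = (\<Sum>u\<in>V. (int (deg u))\<^sup>2)"
  \<comment> \<open>The entry of D^2 at \<open>u\<close> and \<open>v\<close>; \<open>c u v\<close>
    is the entry of A^2.\<close>
  have inner: "int (\<Sum>w\<in>V. diam2_dist u w * diam2_dist w v) = 4 * n - 8 - 2 * int (deg u)
      - 2 * int (deg v) + of_bool (u = v) * 4 + of_bool (E u v) * 4 + c u v"
    if u: "u \<in> V" and v: "v \<in> V" for u v
  proof -
    have "int (diam2_dist u w * diam2_dist w v) = 4 - of_bool (u = w) * 4 - of_bool (v = w) * 4
        - of_bool (E u w) * 2 - of_bool (E v w) * 2 + of_bool (u = w) * (of_bool (u = v) * 4)
        + of_bool (u = w) * (of_bool (E u v) * 2) + of_bool (v = w) * (of_bool (E u v) * 2)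
        + of_bool (E u w) * of_bool (E v w)" for w
      using irrefl nb_commute by (auto simp: diam2_dist_def mem_nb)
    then have "int (\<Sum>w\<in>V. diam2_dist u w * diam2_dist w v) = (\<Sum>w\<in>V.
          4 - of_bool (u = w) * 4 - of_bool (v = w) * 4
        - of_bool (E u w) * 2 - of_bool (E v w) * 2 + of_bool (u = w) * (of_bool (u = v) * 4)
        + of_bool (u = w) * (of_bool (E u v) * 2) + of_bool (v = w) * (of_bool (E u v) * 2)
        + of_bool (E u w) * of_bool (E v w))"
      by simp
    also have "\<dots> = 4 * n - 8 - 2 * int (deg u) - 2 * int (deg v) + of_bool (u = v) * 4
        + of_bool (E u v) * 4 + (\<Sum>w\<in>nb u. of_bool (E v w))"
      unfolding sum_subtractf sum.distrib sum_delta[OF u] sum_delta[OF v] sum_adj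
      by (simp add: deg_def n_def)
    also have "(\<Sum>w\<in>nb u. of_bool (E v w)) = c u v"
      by (simp add: c_def card_common_nb)
    finally show ?thesis .
  qed
  have outer: "int (\<Sum>v\<in>V. (\<Sum>w\<in>V. diam2_dist u w * diam2_dist w v) * diam2_dist v u)
      = 2 * ((4 * n - 8 - 2 * int (deg u)) * n - 2 * s + 4 + 4 * int (deg u) + (\<Sum>v\<in>nb u. int (deg v)))
        - 2 * (4 * n - 4 - 3 * int (deg u))
        - ((4 * n - 4 - 2 * int (deg u)) * int (deg u) - 2 * (\<Sum>v\<in>nb u. int (deg v)) + (\<Sum>v\<in>nb u. c u v))"
    if u: "u \<in> V" for u
  proof -
    let ?K = "4 * n - 8 - 2 * int (deg u)"
    have cuu: "c u u = int (deg u)" by (simp add: c_def deg_def)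
    have "int (\<Sum>v\<in>V. (\<Sum>w\<in>V. diam2_dist u w * diam2_dist w v) * diam2_dist v u)
      = (\<Sum>v\<in>V. (?K - 2 * int (deg v) + of_bool (u = v) * 4 + of_bool (E u v) * 4 + c u v)
           * (2 - 2 * of_bool (u = v) - of_bool (E u v)))"
      by (subst of_nat_sum, intro sum.cong refl, subst of_nat_mult)
        (simp only: inner[OF u] diam2_dist_commute[of _ u] diam2_dist_eq)
    \<comment> \<open>By \<open>irrefl\<close> the two indicators are never both 1, so their product
      drops out.\<close>
    also have "\<dots> = (\<Sum>v\<in>V. 2 * ?K - 4 * int (deg v) + 2 * c u v + of_bool (u = v) * 8
        + of_bool (E u v) * 8 - of_bool (u = v) * (2 * (?K - 2 * int (deg v) + 4 + c u v))
        - of_bool (E u v) * (?K - 2 * int (deg v) + 4 + c u v))"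
      using irrefl by (intro sum.cong refl) (auto simp: of_bool_def algebra_simps)
    also have "\<dots> = 2 * ?K * n - 4 * s + 2 * (\<Sum>v\<in>V. c u v) + 8 + 8 * int (deg u)
        - 2 * (?K - 2 * int (deg u) + 4 + c u u) - (\<Sum>v\<in>nb u. ?K - 2 * int (deg v) + 4 + c u v)"
      unfolding sum_subtractf sum.distrib sum_delta[OF u] sum_adj
      by (simp add: deg_def n_def s_def sum_distrib_left)
    also have "(\<Sum>v\<in>V. c u v) = (\<Sum>v\<in>nb u. int (deg v))"
      unfolding c_def by (rule sum_card_common_nb)
    also have "(\<Sum>v\<in>nb u. ?K - 2 * int (deg v) + 4 + c u v)
        = (?K + 4) * int (deg u) - 2 * (\<Sum>v\<in>nb u. int (deg v)) + (\<Sum>v\<in>nb u. c u v)"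
      by (simp add: sum.distrib sum_subtractf sum_distrib_left algebra_simps deg_def)
    finally show ?thesis unfolding cuu by (simp add: algebra_simps)
  qed
  have nb_deg: "(\<Sum>u\<in>V. \<Sum>v\<in>nb u. int (deg v)) = q"
    unfolding sum_sum_nb q_def by (simp add: power2_eq_square)
  have tri: "(\<Sum>u\<in>V. \<Sum>v\<in>nb u. c u v) = int triangles" by (simp add: triangles_def c_def)
  have "int (\<Sum>u\<in>V. \<Sum>v\<in>V. (\<Sum>w\<in>V. diam2_dist u w * diam2_dist w v) * diam2_dist v u)
    = (\<Sum>u\<in>V. 8 * n\<^sup>2 - 24 * n - 4 * s + 16 + (18 - 8 * n) * int (deg u)
        + 2 * (int (deg u))\<^sup>2 + 4 * (\<Sum>v\<in>nb u. int (deg v)) - (\<Sum>v\<in>nb u. c u v))"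
    by (subst of_nat_sum, intro sum.cong refl, subst outer)
      (simp_all add: power2_eq_square algebra_simps)
  also have "\<dots> = (8 * n\<^sup>2 - 24 * n - 4 * s + 16) * n + (18 - 8 * n) * s + 2 * q + 4 * q - int triangles"
    unfolding sum_subtractf sum.distrib tri
    by (simp add: nb_deg n_def s_def q_def flip: sum_distrib_left, simp add: algebra_simps)
  also have "\<dots> = 8 * n ^ 3 - 24 * n\<^sup>2 + 16 * n + (18 - 12 * n) * s + 6 * q - int triangles"
    by (simp add: power2_eq_square power3_eq_cube algebra_simps)
  finally show ?thesis by (simp add: s_def q_def)
qed

end

section \<open>Distances in a connected graph\<close>

sublocale pair_graph \<subseteq> adj: fin_graph "pverts G" "\<lambda>u v. (u, v) \<in> parcs G"
proof
  show "finite (pverts G)" by (rule pair_finite_verts)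
  show "(v, u) \<in> parcs G" if "(u, v) \<in> parcs G" for u v
    using that pair_sym_arcs by (simp add: symmetric_def symD)
  show "(u, u) \<notin> parcs G" for u using pair_no_loops by fastforce
  show "u \<in> pverts G" if "(u, v) \<in> parcs G" for u v using that by (rule in_arcsD1)
qed

text \<open>Cutting out the closed part between two visits to a vertex shortens a walk. Distances
  are defined by paths, but walks concatenate freely, so this lets the estimates use walks.\<close>

lemma (in wf_digraph) awalk_imp_shorter_apath:
  assumes "awalk u p v"
  shows "\<exists>q. apath u q v \<and> length q \<le> length p"
  using assms
proof (induction "length p" arbitrary: p rule: less_induct)
  case less
  show ?case
  proof (cases "distinct (awalk_verts u p)")
    case True
    then show ?thesis using less.prems by (auto simp: apath_def)
  next
    case False
    then obtain q r s where p: "p = q @ r @ s" "0 < length r"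
      and w: "\<exists>w. awalk u q w \<and> awalk w r w \<and> awalk w s v"
      using awalk_not_distinct_decomp[OF less.prems] by metis
    then have "awalk u (q @ s) v" "length (q @ s) < length p" by auto
    then show ?thesis using less.hyps[of "q @ s"] by fastforce
  qed
qed

context pair_graph
begin

lemma graph_dist_le:
  assumes "awalk u p v"
  shows "graph_dist G u v \<le> length p"
proof -
  obtain q where "apath u q v" "length q \<le> length p" using awalk_imp_shorter_apath[OF assms] by blast
  moreover have "graph_dist G u v \<le> length q"
    unfolding graph_dist_def using \<open>apath u q v\<close> by (intro Least_le) blast
  ultimately show ?thesis by simp
qed

text \<open>Some walk must be given, because \<open>LEAST\<close> over an empty set of lengths has
  no known value.\<close>

lemma ex_shortest_awalk:
  assumes "awalk u p v"
  shows "\<exists>q. awalk u q v \<and> length q = graph_dist G u v"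
proof -
  obtain q where "apath u q v" using awalk_imp_shorter_apath[OF assms] by blast
  then have "\<exists>l. \<exists>q. apath u q v \<and> length q = l" by blast
  from LeastI_ex[OF this] show ?thesis unfolding graph_dist_def apath_def by blast
qed

lemma awalk_1: "awalk u p v \<and> length p = 1 \<longleftrightarrow> (u, v) \<in> parcs G \<and> p = [(u, v)]"
  by (cases p) (auto simp: awalk_simps in_arcsD1 in_arcsD2)

lemma awalk_rev:
  assumes "awalk u p v"
  shows "awalk v (rev (map prod.swap p)) u"
  using assms
proof (induction p arbitrary: u)
  case (Cons e p)
  obtain x y where e: "e = (x, y)" by fastforce
  have "x = u" "(u, y) \<in> parcs G" "awalk y p v" using Cons.prems by (auto simp: e awalk_simps)
  moreover have "awalk y [(y, u)] u"
    using \<open>(u, y) \<in> parcs G\<close> adj.sym by (auto simp: awalk_simps in_arcsD1)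
  ultimately show ?case using Cons.IH by (auto simp: e intro: awalk_appendI)
qed (auto simp: awalk_Nil_iff)

lemma graph_dist_eq_0_iff:
  assumes "awalk u p v"
  shows "graph_dist G u v = 0 \<longleftrightarrow> u = v"
proof
  assume "graph_dist G u v = 0"
  then show "u = v" using ex_shortest_awalk[OF assms] by (auto simp: awalk_Nil_iff)
next
  assume "u = v"
  moreover have "awalk u [] u" using assms by (auto simp: awalk_Nil_iff)
  ultimately show "graph_dist G u v = 0" using graph_dist_le[of u "[]" u] by simp
qed

lemma graph_dist_eq_1_iff:
  assumes "awalk u p v"
  shows "graph_dist G u v = 1 \<longleftrightarrow> (u, v) \<in> parcs G"
proof
  assume "graph_dist G u v = 1"
  then show "(u, v) \<in> parcs G" using ex_shortest_awalk[OF assms] awalk_1 by metis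
next
  assume uv: "(u, v) \<in> parcs G"
  then have "graph_dist G u v \<le> 1" using graph_dist_le[of u "[(u, v)]" v] awalk_1 by fastforce
  moreover have "graph_dist G u v \<noteq> 0" using graph_dist_eq_0_iff[OF assms] uv adj.irrefl by auto
  ultimately show "graph_dist G u v = 1" by simp
qed

lemma common_nb_if_graph_dist_2:
  assumes "awalk u p v" "graph_dist G u v = 2"
  shows "adj.nb u \<inter> adj.nb v \<noteq> {}"
proof -
  obtain q where "awalk u q v" "length q = 2" using ex_shortest_awalk assms by metis
  then obtain e f where "q = [e, f]" by (metis length_0_conv length_Suc_conv numeral_2_eq_2)
  then have "(u, snd e) \<in> parcs G" "(snd e, v) \<in> parcs G"
    using \<open>awalk u q v\<close> by (cases e; cases f; simp add: awalk_simps)+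
  then have "snd e \<in> adj.nb u" "snd e \<in> adj.nb v"
    by (simp_all add: adj.mem_nb adj.sym)
  then show ?thesis by blast
qed

lemma graph_dist_eq_diam2_dist:
  assumes u: "u \<in> pverts G" and v: "v \<in> pverts G"
    and diam: "u \<noteq> v \<Longrightarrow> (u, v) \<notin> parcs G \<Longrightarrow> adj.nb u \<inter> adj.nb v \<noteq> {}"
  shows "graph_dist G u v = adj.diam2_dist u v"
proof -
  consider "u = v" | "(u, v) \<in> parcs G" | "u \<noteq> v" "(u, v) \<notin> parcs G" by blast
  then show ?thesis
  proof cases
    case 1
    then have "awalk u [] v" using u by (simp add: awalk_Nil_iff)
    then show ?thesis using graph_dist_eq_0_iff 1 by (simp add: adj.diam2_dist_def)
  next
    case 2
    then have "awalk u [(u, v)] v" using awalk_1 by blast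
    then show ?thesis using graph_dist_eq_1_iff 2 adj.irrefl by (auto simp: adj.diam2_dist_def)
  next
    case 3
    then obtain w where "(u, w) \<in> parcs G" "(w, v) \<in> parcs G"
      using diam adj.sym by (auto simp: adj.nb_def)
    then have w: "awalk u [(u, w), (w, v)] v" by (auto simp: awalk_simps in_arcsD1 in_arcsD2)
    then have "graph_dist G u v \<le> 2" using graph_dist_le[OF w] by simp
    moreover have "graph_dist G u v \<noteq> 0" "graph_dist G u v \<noteq> 1"
      using 3 graph_dist_eq_0_iff[OF w] graph_dist_eq_1_iff[OF w] by auto
    ultimately show ?thesis using 3 by (simp add: adj.diam2_dist_def)
  qed
qed

end

section \<open>Metric properties and geodesics of connected graphs\<close>

locale connected_pair_graph = pair_graph +
  assumes connected: "Digraph_Component.connected (with_proj G)"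
begin

lemma ex_awalk:
  assumes "u \<in> pverts G" "v \<in> pverts G"
  shows "\<exists>p. awalk u p v"
proof -
  \<comment> \<open>Connectedness means strong connectedness of the symmetric closure, which has the
    same reachability as a symmetric graph itself.\<close>
  have "u \<rightarrow>\<^sup>*\<^bsub>mk_symmetric (with_proj G)\<^esub> v"
    using connected assms unfolding connected_def strongly_connected_def by simp
  then have "u \<rightarrow>\<^sup>*\<^bsub>with_proj G\<^esub> v" using reachable_mk_symmetric_eq[OF pair_sym_arcs] by simp
  then show ?thesis by (simp add: reachable_awalk)
qed

lemma graph_dist_commute:
  assumes "u \<in> pverts G" "v \<in> pverts G"
  shows "graph_dist G u v = graph_dist G v u"
proof -
  have "graph_dist G v u \<le> graph_dist G u v" if "u \<in> pverts G" "v \<in> pverts G" for u v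
    using ex_awalk[OF that] ex_shortest_awalk graph_dist_le awalk_rev by (metis length_map length_rev)
  then show ?thesis using assms by (metis order_antisym)
qed

lemma graph_dist_triangle:
  assumes "u \<in> pverts G" "v \<in> pverts G" "w \<in> pverts G"
  shows "graph_dist G u w \<le> graph_dist G u v + graph_dist G v w"
proof -
  obtain p q where "awalk u p v" "length p = graph_dist G u v" "awalk v q w" "length q = graph_dist G v w"
    using ex_awalk ex_shortest_awalk assms by metis
  then show ?thesis using graph_dist_le[OF awalk_appendI, of u p v q w] by simp
qed

lemma ex_geodesic_3:
  assumes u: "u \<in> pverts G" and v: "v \<in> pverts G" and ge: "graph_dist G u v \<ge> 3"
  obtains a b c where "a \<in> pverts G" "b \<in> pverts G" "c \<in> pverts G"
    "graph_dist G u a = 1" "graph_dist G u b = 2" "graph_dist G u c = 3"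
    "graph_dist G a b = 1" "graph_dist G a c = 2" "graph_dist G b c = 1"
proof -
  obtain p where p: "awalk u p v" "length p = graph_dist G u v"
    using ex_awalk[OF u v] ex_shortest_awalk by blast
  obtain e1 e2 e3 q where q: "p = e1 # e2 # e3 # q"
    using ge p(2) by (metis One_nat_def Suc_le_length_iff numeral_3_eq_3)
  define a b c where "a = snd e1" and "b = snd e2" and "c = snd e3"
  have arcs: "(u, a) \<in> parcs G" "(a, b) \<in> parcs G" "(b, c) \<in> parcs G" and cv: "awalk c q v"
    using p(1) unfolding q a_def b_def c_def
    by (cases e1; cases e2; cases e3; auto simp: awalk_simps)+
  have V: "a \<in> pverts G" "b \<in> pverts G" "c \<in> pverts G" using arcs by (auto dest: in_arcsD2)
  have one: "graph_dist G x y = 1" if "(x, y) \<in> parcs G" for x y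
    using that graph_dist_eq_1_iff awalk_1 by blast
  \<comment> \<open>The rest of the walk reaches \<open>v\<close> from \<open>c\<close> in three
    steps fewer, so \<open>c\<close> is at distance at least 3 from \<open>u\<close>. The three
    edges and triangle inequalities then force all six distances.\<close>
  have "graph_dist G c v + 3 \<le> graph_dist G u v" using graph_dist_le[OF cv] p(2) q by simp
  then have "graph_dist G u c \<ge> 3" using graph_dist_triangle[OF u V(3) v] by simp
  then have "graph_dist G u a = 1" "graph_dist G u b = 2" "graph_dist G u c = 3"
    "graph_dist G a b = 1" "graph_dist G a c = 2" "graph_dist G b c = 1"
    using one[OF arcs(1)] one[OF arcs(2)] one[OF arcs(3)] graph_dist_triangle[OF u V(1) V(2)]
      graph_dist_triangle[OF u V(1) V(3)] graph_dist_triangle[OF u V(2) V(3)]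
      graph_dist_triangle[OF V]
    by linarith+
  then show thesis using that V by blast
qed

end

section \<open>The distance spectrum\<close>

text \<open>Eigenvectors are written as functions on indices, ready to be moved to functions on
  vertices.\<close>

lemma mem_proots_char_poly_iff:
  fixes A :: "'a :: field mat"
  assumes A: "A \<in> carrier_mat n n"
  shows "e \<in># proots (char_poly A) \<longleftrightarrow>
    (\<exists>x. (\<exists>i<n. x i \<noteq> 0) \<and> (\<forall>i<n. (\<Sum>j<n. A $$ (i, j) * x j) = e * x i))"
proof -
  have "char_poly A \<noteq> 0" using degree_monic_char_poly[OF A] by auto
  then have "e \<in># proots (char_poly A) \<longleftrightarrow> (\<exists>w. eigenvector A w e)"
    using A by (simp add: eigenvalue_root_char_poly[OF A, symmetric] eigenvalue_def)
  also have "\<dots> \<longleftrightarrow> (\<exists>x. (\<exists>i<n. x i \<noteq> 0) \<and> (\<forall>i<n. (\<Sum>j<n. A $$ (i, j) * x j) = e * x i))"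
    (is "?L \<longleftrightarrow> ?R")
  proof
    assume ?L
    then obtain w where w: "w \<in> carrier_vec n" "w \<noteq> 0\<^sub>v n" "A *\<^sub>v w = e \<cdot>\<^sub>v w"
      using A by (auto simp: eigenvector_def)
    have "\<exists>i<n. w $ i \<noteq> 0" using w(1,2) by (metis carrier_vecD eq_vecI index_zero_vec)
    moreover have "(\<Sum>j<n. A $$ (i, j) * w $ j) = e * w $ i" if "i < n" for i
      using arg_cong[OF w(3), of "\<lambda>v. v $ i"] that w(1) A
      by (simp add: scalar_prod_def atLeast0LessThan)
    ultimately show ?R by (intro exI[of _ "\<lambda>i. w $ i"]) blast
  next
    assume ?R
    then obtain x i where x: "i < n" "x i \<noteq> 0" "\<And>i. i < n \<Longrightarrow> (\<Sum>j<n. A $$ (i, j) * x j) = e * x i"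
      by blast
    have "vec n x \<noteq> 0\<^sub>v n" using x(1,2) by (metis index_vec index_zero_vec(1))
    moreover have "A *\<^sub>v vec n x = e \<cdot>\<^sub>v vec n x"
      using A x(3) by (intro eq_vecI) (auto simp: scalar_prod_def atLeast0LessThan)
    ultimately show ?L using A by (auto simp: eigenvector_def intro: exI[of _ "vec n x"])
  qed
  finally show ?thesis .
qed

section \<open>The distance spectrum in terms of vertices\<close>

context pair_graph
begin

lemma obtain_vertex_enum:
  obtains vs where "is_vertex_enum G vs"
  using finite_distinct_list[OF pair_finite_verts] by (auto simp: is_vertex_enum_def)

lemma length_vertex_enum: "is_vertex_enum G vs \<Longrightarrow> length vs = card (pverts G)"
  using distinct_card[of vs] by (simp add: is_vertex_enum_def)

lemma bij_betw_vertex_enum: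
  "is_vertex_enum G vs \<Longrightarrow> bij_betw (\<lambda>i. vs ! i) {..<length vs} (pverts G)"
  by (simp add: is_vertex_enum_def bij_betw_nth)

lemma sum_vertex_enum:
  "is_vertex_enum G vs \<Longrightarrow> (\<Sum>v\<in>pverts G. f v) = (\<Sum>i<length vs. f (vs ! i))"
  using sum.reindex_bij_betw[OF bij_betw_vertex_enum, of vs f] by simp

lemma size_dist_spectrum: "size (dist_spectrum G) = card (pverts G)"
proof -
  obtain vs where vs: "is_vertex_enum G vs" by (rule obtain_vertex_enum)
  have "dist_matrix G vs \<in> carrier_mat (length vs) (length vs)" by (simp add: dist_matrix_def)
  from degree_monic_char_poly[OF this] show ?thesis
    by (simp add: dist_spectrum_eq[OF vs] size_proots_complex length_vertex_enum[OF vs])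
qed

lemma dist_spectrum_moment_2:
  "(\<Sum>e\<in>#dist_spectrum G. e ^ 2)
    = of_nat (\<Sum>u\<in>pverts G. \<Sum>v\<in>pverts G. graph_dist G u v * graph_dist G v u)"
proof -
  obtain vs where vs: "is_vertex_enum G vs" by (rule obtain_vertex_enum)
  let ?D = "dist_matrix G vs" and ?n = "length vs"
  have D: "?D \<in> carrier_mat ?n ?n" by (simp add: dist_matrix_def)
  have "(\<Sum>e\<in>#dist_spectrum G. e ^ 2) = mat_trace (?D ^\<^sub>m 2)"
    by (simp add: dist_spectrum_eq[OF vs] mat_trace_pow_eq_sum_roots[OF D])
  also have "\<dots> = mat_trace (?D * ?D)" using D by (simp add: numeral_2_eq_2)
  also have "\<dots> = of_nat (\<Sum>i<?n. \<Sum>j<?n.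
      graph_dist G (vs ! i) (vs ! j) * graph_dist G (vs ! j) (vs ! i))"
    by (simp add: mat_trace_mult[OF D D], simp add: dist_matrix_def)
  finally show ?thesis by (simp only: sum_vertex_enum[OF vs])
qed

lemma dist_spectrum_moment_3:
  "(\<Sum>e\<in>#dist_spectrum G. e ^ 3)
    = of_nat (\<Sum>u\<in>pverts G. \<Sum>v\<in>pverts G.
        (\<Sum>w\<in>pverts G. graph_dist G u w * graph_dist G w v) * graph_dist G v u)"
proof -
  obtain vs where vs: "is_vertex_enum G vs" by (rule obtain_vertex_enum)
  let ?D = "dist_matrix G vs" and ?n = "length vs"
  have D: "?D \<in> carrier_mat ?n ?n" by (simp add: dist_matrix_def)
  have "(\<Sum>e\<in>#dist_spectrum G. e ^ 3) = mat_trace (?D ^\<^sub>m 3)"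
    by (simp add: dist_spectrum_eq[OF vs] mat_trace_pow_eq_sum_roots[OF D])
  also have "\<dots> = mat_trace ((?D * ?D) * ?D)" using D by (simp add: numeral_3_eq_3)
  also have "\<dots> = (\<Sum>i<?n. \<Sum>j<?n. (?D * ?D) $$ (i, j) * ?D $$ (j, i))"
    by (rule mat_trace_mult) (use D in auto)
  also have "\<dots> = of_nat (\<Sum>i<?n. \<Sum>j<?n.
      (\<Sum>l<?n. graph_dist G (vs ! i) (vs ! l) * graph_dist G (vs ! l) (vs ! j))
        * graph_dist G (vs ! j) (vs ! i))"
    by (simp add: dist_matrix_def scalar_prod_def atLeast0LessThan)
  finally show ?thesis by (simp only: sum_vertex_enum[OF vs])
qed

lemma mem_dist_spectrum_iff:
  "e \<in># dist_spectrum G \<longleftrightarrow> (\<exists>x. (\<exists>v\<in>pverts G. x v \<noteq> 0) \<and>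
    (\<forall>u\<in>pverts G. (\<Sum>v\<in>pverts G. of_nat (graph_dist G u v) * x v) = e * x u))"
  (is "?L \<longleftrightarrow> ?R")
proof -
  obtain vs where vs: "is_vertex_enum G vs" by (rule obtain_vertex_enum)
  let ?n = "length vs"
  have V: "pverts G = (\<lambda>i. vs ! i) ` {..<?n}" and inj: "inj_on (\<lambda>i. vs ! i) {..<?n}"
    using bij_betw_vertex_enum[OF vs] by (auto simp: bij_betw_def)
  have "?L \<longleftrightarrow> (\<exists>x. (\<exists>i<?n. x i \<noteq> 0) \<and>
      (\<forall>i<?n. (\<Sum>j<?n. of_nat (graph_dist G (vs ! i) (vs ! j)) * x j) = e * x i))"
    (is "_ \<longleftrightarrow> ?M")
    unfolding dist_spectrum_eq[OF vs]
    by (subst mem_proots_char_poly_iff[of _ ?n]) (simp_all add: dist_matrix_def)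
  also have "?M \<longleftrightarrow> ?R"
  proof
    assume ?M
    then obtain x where x: "\<exists>i<?n. x i \<noteq> 0"
      "\<And>i. i < ?n \<Longrightarrow> (\<Sum>j<?n. of_nat (graph_dist G (vs ! i) (vs ! j)) * x j) = e * x i" by blast
    \<comment> \<open>An eigenvector on indices is moved to the vertices by inverting the
      enumeration.\<close>
    define y where "y v = x (inv_into {..<?n} (\<lambda>i. vs ! i) v)" for v
    have y: "y (vs ! i) = x i" if "i < ?n" for i
      using inj that by (simp add: y_def inv_into_f_f)
    have "(\<Sum>v\<in>pverts G. of_nat (graph_dist G (vs ! i) v) * y v) = e * y (vs ! i)" if "i < ?n" for i
      using x(2)[OF that] that by (simp add: y sum_vertex_enum[OF vs])
    then show ?R using x(1) y by (intro exI[of _ y]) (auto simp: V)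
  next
    assume ?R
    then obtain y where y: "\<exists>v\<in>pverts G. y v \<noteq> 0"
      "\<And>u. u \<in> pverts G \<Longrightarrow> (\<Sum>v\<in>pverts G. of_nat (graph_dist G u v) * y v) = e * y u" by blast
    have "(\<Sum>j<?n. of_nat (graph_dist G (vs ! i) (vs ! j)) * y (vs ! j)) = e * y (vs ! i)"
      if i: "i < ?n" for i
    proof -
      have "vs ! i \<in> pverts G" using i V by blast
      from y(2)[OF this] show ?thesis by (simp only: sum_vertex_enum[OF vs])
    qed
    moreover have "\<exists>i<?n. y (vs ! i) \<noteq> 0" using y(1) unfolding V by blast
    ultimately show ?M by (intro exI[of _ "\<lambda>i. y (vs ! i)"]) blast
  qed
  finally show ?thesis .
qed

end

text \<open>The Rayleigh bound from below, reduced to \<open>quad_form_le_of_eigenvalues_le\<close>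
  for c I - D, whose eigenvalues \<open>c - r\<close> lie between 0 and
  \<open>c + t\<close>.\<close>

lemma (in connected_pair_graph) dist_form_ge:
  fixes x :: "'a \<Rightarrow> real" and t :: real
  assumes ev: "\<And>e. e \<in># dist_spectrum G \<Longrightarrow> \<exists>r. e = of_real r \<and> r \<ge> - t"
  shows "(\<Sum>u\<in>pverts G. \<Sum>v\<in>pverts G. graph_dist G u v * x u * x v) \<ge> - t * (\<Sum>v\<in>pverts G. (x v)\<^sup>2)"
proof -
  obtain vs where vs: "is_vertex_enum G vs" by (rule obtain_vertex_enum)
  let ?n = "length vs"
  have vsV: "vs ! i \<in> pverts G" if "i < ?n" for i
    using vs that by (metis is_vertex_enum_def nth_mem)
  obtain c where c: "\<And>e. e \<in># dist_spectrum G \<Longrightarrow> cmod e \<le> c"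
    using that[of "Max (cmod ` set_mset (dist_spectrum G))"] by simp
  \<comment> \<open>For large \<open>c\<close> the least eigenvalue of \<open>D\<close> gives the eigenvalue of \<open>c I - D\<close> of largest modulus.\<close>
  define A where "A = mat ?n ?n (\<lambda>(i, j). c * of_bool (i = j) - real (graph_dist G (vs ! i) (vs ! j)))"
  have A: "A \<in> carrier_mat ?n ?n" by (simp add: A_def)
  have Ac: "map_mat complex_of_real A \<in> carrier_mat ?n ?n" using A by simp
  have D: "dist_matrix G vs \<in> carrier_mat ?n ?n" by (simp add: dist_matrix_def)
  have "transpose_mat A = A"
  proof (rule eq_matI)
    fix i j assume "i < dim_row A" "j < dim_col A"
    then have ij: "i < ?n" "j < ?n" by (simp_all add: A_def)
    then show "transpose_mat A $$ (i, j) = A $$ (i, j)"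
      using graph_dist_commute[OF vsV[OF ij(1)] vsV[OF ij(2)]]
      by (cases "i = j") (simp_all add: A_def)
  qed (simp_all add: A_def)
  moreover have "cmod e \<le> c + t" if e: "e \<in># proots (char_poly (map_mat complex_of_real A))" for e
  proof -
    obtain y where y: "\<exists>i<?n. y i \<noteq> 0"
      "\<And>i. i < ?n \<Longrightarrow> (\<Sum>j<?n. map_mat complex_of_real A $$ (i, j) * y j) = e * y i"
      using e unfolding mem_proots_char_poly_iff[OF Ac] by blast
    \<comment> \<open>D and c I - D share their eigenvectors, so \<open>e\<close> corresponds to the
      eigenvalue \<open>c - e\<close> of D.\<close>
    have "(\<Sum>j<?n. dist_matrix G vs $$ (i, j) * y j) = (c - e) * y i" if i: "i < ?n" for i
    proof -
      have "(\<Sum>j<?n. map_mat complex_of_real A $$ (i, j) * y j)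
          = (\<Sum>j<?n. (if i = j then c * y j else 0) - dist_matrix G vs $$ (i, j) * y j)"
        using i by (intro sum.cong) (auto simp: A_def dist_matrix_def algebra_simps)
      also have "\<dots> = c * y i - (\<Sum>j<?n. dist_matrix G vs $$ (i, j) * y j)"
        using i by (simp add: sum_subtractf)
      finally show ?thesis using y(2)[OF i] by (simp add: algebra_simps)
    qed
    then have ce: "of_real c - e \<in># dist_spectrum G"
      unfolding dist_spectrum_eq[OF vs] mem_proots_char_poly_iff[OF D] using y(1) by blast
    obtain r where r: "of_real c - e = of_real r" "r \<ge> - t" using ev[OF ce] by blast
    have "r \<le> c" using c[OF ce] r(1) by simp
    moreover have "e = of_real (c - r)" using r(1) by (simp add: algebra_simps)
    ultimately show ?thesis using r(2) by (simp only: norm_of_real)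
  qed
  ultimately have "quad_form A (\<lambda>i. x (vs ! i)) \<le> (c + t) * (\<Sum>i<?n. (x (vs ! i))\<^sup>2)"
    using A by (intro quad_form_le_of_eigenvalues_le)
  moreover have "quad_form A (\<lambda>i. x (vs ! i)) = c * (\<Sum>i<?n. (x (vs ! i))\<^sup>2)
      - (\<Sum>i<?n. \<Sum>j<?n. graph_dist G (vs ! i) (vs ! j) * x (vs ! i) * x (vs ! j))"
  proof -
    have "quad_form A (\<lambda>i. x (vs ! i)) = (\<Sum>i<?n. \<Sum>j<?n. (if i = j then c * x (vs ! i) * x (vs ! j) else 0)
        - graph_dist G (vs ! i) (vs ! j) * x (vs ! i) * x (vs ! j))"
      unfolding quad_form_def using A
      by (intro sum.cong) (auto simp: A_def algebra_simps)
    then show ?thesis by (simp add: sum_subtractf sum_distrib_left power2_eq_square mult_ac)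
  qed
  ultimately show ?thesis by (simp only: sum_vertex_enum[OF vs]) (simp add: algebra_simps)
qed

section \<open>Friendship graphs\<close>

text \<open>The orbits of a fixed-point-free involution are pairs, removed one at a time. Numbering
  the orbits and their two elements matches the vertex names in k copies of K_2.\<close>

lemma bij_betw_pairs_if_involution:
  fixes W :: "'a set"
  assumes "finite W"
    and "\<And>w. w \<in> W \<Longrightarrow> m w \<in> W" "\<And>w. w \<in> W \<Longrightarrow> m w \<noteq> w" "\<And>w. w \<in> W \<Longrightarrow> m (m w) = w"
  shows "\<exists>k g. bij_betw g ({..<k :: nat} \<times> {..<2 :: nat}) W \<and> (\<forall>i<k. m (g (i, 0)) = g (i, 1))"
  using assms
proof (induction W rule: finite_psubset_induct)
  case (psubset W)
  show ?case
  proof (cases "W = {}")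
    case True
    then show ?thesis by (intro exI[of _ 0]) (simp add: bij_betw_def)
  next
    case False
    then obtain w where w: "w \<in> W" by blast
    note m = psubset.prems
    define W' where "W' = W - {w, m w}"
    have "W' \<subset> W" using w by (auto simp: W'_def)
    moreover have "m x \<in> W'" if "x \<in> W'" for x
    proof -
      have x: "x \<in> W" "x \<noteq> w" "x \<noteq> m w" using that by (auto simp: W'_def)
      have "m x \<noteq> w" using m(3)[OF x(1)] x(3) by auto
      moreover have "m x \<noteq> m w" using m(3)[OF x(1)] m(3)[OF w] x(2) by metis
      ultimately show ?thesis using that m(1) by (simp add: W'_def)
    qed
    moreover have "m x \<noteq> x" "m (m x) = x" if "x \<in> W'" for x using that m by (auto simp: W'_def)
    ultimately have "\<exists>k g. bij_betw g ({..<k :: nat} \<times> {..<2 :: nat}) W' \<and> (\<forall>i<k. m (g (i, 0)) = g (i, 1))"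
      by (rule psubset.IH)
    then obtain k g where g: "bij_betw g ({..<k :: nat} \<times> {..<2 :: nat}) W'"
      and mg: "\<And>i. i < k \<Longrightarrow> m (g (i, 0)) = g (i, 1)"
      by blast
    define g' where "g' = g((k, 0) := w, (k, 1) := m w)"
    have "bij_betw g' ({..<k} \<times> {..<2}) W'"
      using g by (subst bij_betw_cong[of _ g' g]) (auto simp: g'_def)
    moreover have "bij_betw g' {(k, 0), (k, 1)} {w, m w}"
      using m(2)[OF w] by (auto simp: g'_def bij_betw_def inj_on_def)
    ultimately have "bij_betw g' ({..<k} \<times> {..<2} \<union> {(k, 0), (k, 1)}) (W' \<union> {w, m w})"
      by (rule bij_betw_combine) (auto simp: W'_def)
    moreover have "{..<k} \<times> {..<2} \<union> {(k, 0), (k, 1)} = {..<Suc k} \<times> {..<2 :: nat}" by auto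
    moreover have "W' \<union> {w, m w} = W" using w m(1) by (auto simp: W'_def)
    ultimately have "bij_betw g' ({..<Suc k} \<times> {..<2}) W" by simp
    moreover have "m (g' (i, 0)) = g' (i, 1)" if "i < Suc k" for i
      using mg that by (auto simp: g'_def less_Suc_eq)
    ultimately show ?thesis by blast
  qed
qed

text \<open>This quadratic governs the eigenvectors that are constant off the centre. A non-real
  root would have squared modulus -2k, the product of the roots.\<close>

lemma quadratic_root_real:
  fixes z :: complex
  assumes k: "k \<ge> (1 :: nat)" and z: "z * (z + 3 - 4 * of_nat k) = 2 * of_nat k"
  shows "\<exists>r. z = of_real r \<and> r \<ge> -3 \<and> r \<noteq> -2"
proof -
  define a b where "a = Re z" and "b = Im z"
  have re: "a\<^sup>2 - b\<^sup>2 + (3 - 4 * real k) * a = 2 * real k"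
    and im: "b * (2 * a + 3 - 4 * real k) = 0"
    using arg_cong[OF z, of Re] arg_cong[OF z, of Im]
    by (simp_all add: a_def b_def power2_eq_square algebra_simps)
  have "b = 0"
  proof (rule ccontr)
    assume "b \<noteq> 0"
    then have "3 - 4 * real k = - 2 * a" using im by simp
    then have "- (a\<^sup>2 + b\<^sup>2) = 2 * real k" using re by (simp add: power2_eq_square)
    moreover have "a\<^sup>2 + b\<^sup>2 \<ge> 0" by simp
    ultimately show False using k by simp
  qed
  then have za: "z = of_real a" by (simp add: a_def b_def complex_eq_iff)
  have quad: "a * (a + 3 - 4 * real k) = 2 * real k"
    using re \<open>b = 0\<close> by (simp add: power2_eq_square algebra_simps)
  have "a \<ge> -3"
  proof (rule ccontr)
    assume "\<not> a \<ge> -3"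
    \<comment> \<open>Below -3 the negated factors are at least 3 and 4k, so their product exceeds
      2k.\<close>
    then have "3 * (4 * real k) \<le> (- a) * (- (a + 3 - 4 * real k))" using k by (intro mult_mono) auto
    also have "\<dots> = 2 * real k" using quad by (simp add: algebra_simps)
    finally show False using k by simp
  qed
  moreover have "a \<noteq> -2"
  proof
    assume "a = -2"
    then have "6 * real k = 2" using quad by simp
    then show False using k by simp
  qed
  ultimately show ?thesis using za by blast
qed

section \<open>Structure and distance eigenvalues of friendship graphs\<close>

text \<open>Degrees alone capture friendship graphs: every vertex other than the dominating one has
  a single further neighbour, which gives a perfect matching. The locale serves both
  \<open>friendship_graph k\<close> and, in the end, \<open>H\<close>.\<close>

locale friendship = fin_graph +
  fixes c :: 'a and k :: nat
  assumes c: "c \<in> V" "nb c = V - {c}"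
    and deg_2: "\<And>u. u \<in> V \<Longrightarrow> u \<noteq> c \<Longrightarrow> deg u = 2"
    and card_V: "card V = 2 * k + 1"
begin

definition mate :: "'a \<Rightarrow> 'a" where "mate u = (THE m. nb u - {c} = {m})"

lemma nb_eq:
  assumes "u \<in> V" "u \<noteq> c"
  shows "nb u = {c, mate u}" "mate u \<noteq> c"
proof -
  have cu: "c \<in> nb u" using assms c by (simp add: nb_commute[of c])
  then have "card (nb u - {c}) = 1" using deg_2[OF assms] by (simp add: deg_def)
  then obtain m where m: "nb u - {c} = {m}" by (rule card_1_singletonE)
  then have "mate u = m" by (simp add: mate_def)
  then show "nb u = {c, mate u}" "mate u \<noteq> c" using m cu by auto
qed

lemma mate:
  assumes "u \<in> V" "u \<noteq> c"
  shows "mate u \<in> V" "mate u \<noteq> c" "mate u \<noteq> u" "mate (mate u) = u"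
proof -
  have mu: "mate u \<in> nb u" using nb_eq[OF assms] by simp
  then show "mate u \<in> V" "mate u \<noteq> u" using nb_subset by blast+
  show "mate u \<noteq> c" by (rule nb_eq(2)[OF assms])
  have "u \<in> nb (mate u)" using mu by (simp add: nb_commute)
  then show "mate (mate u) = u" using nb_eq(1)[OF \<open>mate u \<in> V\<close> \<open>mate u \<noteq> c\<close>] assms by simp
qed

lemma adj_iff:
  assumes "u \<in> V" "v \<in> V"
  shows "E u v \<longleftrightarrow> u \<noteq> v \<and> (u = c \<or> v = c \<or> v = mate u)"
proof (cases "u = c")
  case True
  then show ?thesis using c assms by (auto simp flip: mem_nb)
next
  case False
  then show ?thesis using nb_eq[OF assms(1) False] mate[OF assms(1) False] by (auto simp flip: mem_nb)
qed

lemma diam_le_2: diam_le_2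
  unfolding diam_le_2_def
proof (intro ballI impI)
  fix u v assume uv: "u \<in> V" "v \<in> V" "u \<noteq> v" "\<not> E u v"
  then have "u \<noteq> c" "v \<noteq> c" using adj_iff by blast+
  then show "nb u \<inter> nb v \<noteq> {}" using nb_eq uv by auto
qed

lemma sum_c: "(\<Sum>u\<in>V. f u) = f c + (\<Sum>u\<in>V - {c}. f u)"
  using c finite_V by (simp add: sum.remove)

lemma card_rest: "card (V - {c}) = 2 * k"
  using c card_V by simp

lemma deg_c: "deg c = 2 * k"
  using c card_rest by (simp add: deg_def)

lemma sum_deg: "(\<Sum>u\<in>V. deg u) = 6 * k"
  unfolding sum_c using card_rest by (simp add: deg_2 deg_c)

lemma sum_deg_2: "(\<Sum>u\<in>V. (deg u)\<^sup>2) = 4 * k\<^sup>2 + 8 * k"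
  unfolding sum_c using card_rest by (simp add: deg_2 deg_c power_mult_distrib)

text \<open>Every edge lies in exactly one triangle, so the count equals the degree sum.\<close>

lemma triangles_eq: "triangles = 6 * k"
proof -
  have c1: "card (nb c \<inter> nb v) = 1" if "v \<in> V" "v \<noteq> c" for v
  proof -
    have "nb c \<inter> nb v = {mate v}" using nb_eq[OF that] mate[OF that] c by auto
    then show ?thesis by simp
  qed
  have "card (nb u \<inter> nb v) = 1" if "u \<in> V" "v \<in> nb u" for u v
  proof -
    have v: "v \<in> V" "v \<noteq> u" using that(2) nb_subset by blast+
    consider "u = c" | "v = c" "u \<noteq> c" | "u \<noteq> c" "v \<noteq> c" by blast
    then show ?thesis
    proof cases
      case 1
      then show ?thesis using c1 v by simp
    next
      case 2
      then show ?thesis using c1[OF that(1) 2(2)] by (simp add: Int_commute)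
    next
      case 3
      then have "v = mate u" using that nb_eq[OF that(1)] by auto
      then have "nb v = {c, u}" using nb_eq[OF v(1) 3(2)] mate[OF that(1) 3(1)] by simp
      then have "nb u \<inter> nb v = {c}" using nb_eq[OF that(1) 3(1)] \<open>v = mate u\<close> v 3 by auto
      then show ?thesis by simp
    qed
  qed
  then have "triangles = (\<Sum>u\<in>V. deg u)" by (simp add: triangles_def deg_def)
  then show ?thesis by (simp add: sum_deg)
qed

text \<open>Subtracting the equations at \<open>u\<close> and \<open>mate u\<close> gives (z + 1)(x
  u - x (mate u)) = 0. So unless \<open>z\<close> is -1 or -3, \<open>x\<close> is constant off the
  centre, and the equations at \<open>c\<close> and off \<open>c\<close> combine to the quadratic of
  \<open>quadratic_root_real\<close>.\<close>

lemma eigenvalue_real: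
  fixes z :: complex
  assumes k: "k \<ge> 1" and nz: "\<exists>v\<in>V. x v \<noteq> 0"
    and ev: "\<And>u. u \<in> V \<Longrightarrow> (\<Sum>v\<in>V. of_nat (diam2_dist u v) * x v) = z * x u"
  shows "\<exists>r. z = of_real r \<and> r \<ge> -3 \<and> r \<noteq> -2"
proof -
  define R where "R = (\<Sum>v\<in>V - {c}. x v)"
  have "(\<Sum>v\<in>V. of_nat (diam2_dist c v) * x v) = (\<Sum>v\<in>V - {c}. of_nat (diam2_dist c v) * x v)"
    unfolding sum_c by (simp add: diam2_dist_def)
  also have "\<dots> = R"
    unfolding R_def using c by (intro sum.cong) (auto simp: diam2_dist_def simp flip: mem_nb)
  finally have evc: "R = z * x c" using ev[OF c(1)] by simp
  \<comment> \<open>The distance from \<open>u\<close> is 2 except to \<open>u\<close>,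
    \<open>c\<close> and \<open>mate u\<close>.\<close>
  have evu: "x c + 2 * R - 2 * x u - x (mate u) = z * x u" if u: "u \<in> V" "u \<noteq> c" for u
  proof -
    have "of_nat (diam2_dist u v) * x v = 2 * x v - of_bool (u = v) * (2 * x v)
        - of_bool (c = v) * x v - of_bool (mate u = v) * x v" if v: "v \<in> V" for v
      using adj_iff[OF u(1) v] u mate[OF u] by (auto simp: diam2_dist_def)
    then have "(\<Sum>v\<in>V. of_nat (diam2_dist u v) * x v) = (\<Sum>v\<in>V. 2 * x v - of_bool (u = v) * (2 * x v)
        - of_bool (c = v) * x v - of_bool (mate u = v) * x v)"
      by (intro sum.cong) auto
    also have "\<dots> = 2 * (\<Sum>v\<in>V. x v) - 2 * x u - x c - x (mate u)"
      unfolding sum_subtractf sum_delta[OF u(1)] sum_delta[OF c(1)] sum_delta[OF mate(1)[OF u]]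
      by (simp add: sum_distrib_left)
    also have "(\<Sum>v\<in>V. x v) = x c + R" unfolding R_def by (rule sum_c)
    finally show ?thesis using ev[OF u(1)] by (simp add: algebra_simps)
  qed
  show ?thesis
  proof (cases "z = -1 \<or> z = -3")
    case True
    then show ?thesis by (auto intro: exI[of _ "-1"] exI[of _ "-3"])
  next
    case False
    define t where "t = (x c + 2 * R) / (z + 3)"
    have z3: "z + 3 \<noteq> 0" using False by (metis add.commute add_eq_0_iff)
    have z1: "z + 1 \<noteq> 0" using False by (metis add.commute add_eq_0_iff)
    have xu: "x u = t" if u: "u \<in> V" "u \<noteq> c" for u
    proof -
      have "(z + 1) * (x u - x (mate u)) = 0"
        using evu[OF u] evu[OF mate(1,2)[OF u]] mate(4)[OF u] by (simp add: algebra_simps)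
      then have "x (mate u) = x u" using z1 by simp
      then have "(z + 3) * x u = x c + 2 * R" using evu[OF u] by (simp add: algebra_simps)
      then show ?thesis using z3 by (simp add: t_def field_simps)
    qed
    have R: "R = 2 * of_nat k * t" unfolding R_def using card_rest by (simp add: xu)
    have t: "(z + 3) * t = x c + 2 * R" using z3 by (simp add: t_def)
    \<comment> \<open>This allows \<open>t\<close> to be cancelled from the quadratic; otherwise
      \<open>x\<close> would vanish everywhere.\<close>
    have "t \<noteq> 0"
    proof
      assume "t = 0"
      then have "x c = 0" using t R by simp
      then show False using nz xu \<open>t = 0\<close> by metis
    qed
    moreover have "t * (z * (z + 3 - 4 * of_nat k)) = t * (2 * of_nat k)"
    proof -
      have "x c = (z + 3 - 4 * of_nat k) * t" using t R by (simp add: algebra_simps)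
      then have "z * ((z + 3 - 4 * of_nat k) * t) = 2 * of_nat k * t"
        using evc R by (simp only:)
      then show ?thesis by (simp only: mult_ac)
    qed
    ultimately show ?thesis using quadratic_root_real[OF k] by (metis mult_left_cancel)
  qed
qed

lemma ex_pairing:
  "\<exists>g. bij_betw g ({..<k} \<times> {..<2 :: nat}) (V - {c}) \<and> (\<forall>i<k. mate (g (i, 0)) = g (i, 1))"
proof -
  have "\<exists>l g. bij_betw g ({..<l :: nat} \<times> {..<2 :: nat}) (V - {c}) \<and> (\<forall>i<l. mate (g (i, 0)) = g (i, 1))"
    by (rule bij_betw_pairs_if_involution) (simp_all add: finite_V mate)
  then obtain l g where g: "bij_betw g ({..<l :: nat} \<times> {..<2 :: nat}) (V - {c})"
    "\<forall>i<l. mate (g (i, 0)) = g (i, 1)"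
    by blast
  moreover have "l = k" using bij_betw_same_card[OF g(1)] card_rest by (simp add: card_cartesian_product)
  ultimately show ?thesis by blast
qed

end

lemma (in pair_graph) graph_dist_eq_if_diam_le_2:
  assumes adj.diam_le_2 "u \<in> pverts G" "v \<in> pverts G"
  shows "graph_dist G u v = adj.diam2_dist u v"
  using assms by (intro graph_dist_eq_diam2_dist) (simp_all add: adj.diam_le_2_def)

lemma (in pair_graph) dist_spectrum_friendship:
  assumes fr: "friendship (pverts G) (\<lambda>u v. (u, v) \<in> parcs G) c k" and k: "k \<ge> 1"
    and e: "e \<in># dist_spectrum G"
  shows "\<exists>r. e = of_real r \<and> r \<ge> -3 \<and> r \<noteq> -2"
proof -
  interpret fr: friendship "pverts G" "\<lambda>u v. (u, v) \<in> parcs G" c k by (rule fr)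
  have dist: "graph_dist G u v = adj.diam2_dist u v" if "u \<in> pverts G" "v \<in> pverts G" for u v
    using fr.diam_le_2 that by (rule graph_dist_eq_if_diam_le_2)
  obtain x where "\<exists>v\<in>pverts G. x v \<noteq> 0"
    and x: "\<And>u. u \<in> pverts G \<Longrightarrow> (\<Sum>v\<in>pverts G. of_nat (graph_dist G u v) * x v) = e * x u"
    using e unfolding mem_dist_spectrum_iff by blast
  moreover have "(\<Sum>v\<in>pverts G. of_nat (adj.diam2_dist u v) * x v) = e * x u" if u: "u \<in> pverts G" for u
    using x[OF u] by (simp add: dist[OF u])
  ultimately show ?thesis using fr.eigenvalue_real[OF k] by blast
qed

lemma (in pair_graph)
  assumes diam: adj.diam_le_2
  defines "n \<equiv> int (card (pverts G))"
  shows dist_spectrum_moment_2_diam2: "(\<Sum>e\<in>#dist_spectrum G. e ^ 2)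
      = of_int (4 * n\<^sup>2 - 4 * n - 3 * int (\<Sum>u\<in>pverts G. adj.deg u))" (is ?thesis2)
    and dist_spectrum_moment_3_diam2: "(\<Sum>e\<in>#dist_spectrum G. e ^ 3)
      = of_int (8 * n ^ 3 - 24 * n\<^sup>2 + 16 * n + (18 - 12 * n) * int (\<Sum>u\<in>pverts G. adj.deg u)
        + 6 * int (\<Sum>u\<in>pverts G. (adj.deg u)\<^sup>2) - int adj.triangles)" (is ?thesis3)
proof -
  have dist: "graph_dist G u v = adj.diam2_dist u v" if "u \<in> pverts G" "v \<in> pverts G" for u v
    using diam that by (rule graph_dist_eq_if_diam_le_2)
  show ?thesis2
    unfolding n_def adj.sum_diam2_dist_2[symmetric] dist_spectrum_moment_2 of_int_of_nat_eq
    by (intro arg_cong[of _ _ of_nat] sum.cong refl) (simp add: dist)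
  show ?thesis3
    unfolding n_def adj.sum_diam2_dist_3[symmetric] dist_spectrum_moment_3 of_int_of_nat_eq
    by (intro arg_cong[of _ _ of_nat] sum.cong refl) (simp add: dist cong: sum.cong)
qed

section \<open>Isomorphism with the constructed friendship graph\<close>

lemma pverts_friendship_graph:
  "pverts (friendship_graph k) = insert (Inl 0) (Inr ` ({..<k} \<times> {..<2}))"
  by (auto simp: friendship_graph_def graph_join_def graph_copies_def complete_graph_def)

text \<open>On the indices 0 and 1 the difference \<open>1 - j\<close> is the swap, so it names the
  other vertex of a copy of K_2.\<close>

lemma parcs_friendship_graph:
  "(u, v) \<in> parcs (friendship_graph k) \<longleftrightarrow>
    u \<in> pverts (friendship_graph k) \<and> v \<in> pverts (friendship_graph k) \<and> u \<noteq> v \<and>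
    (u = Inl 0 \<or> v = Inl 0 \<or> (\<exists>i j. u = Inr (i, j) \<and> v = Inr (i, 1 - j)))"
proof -
  have "j \<noteq> j' \<longleftrightarrow> j' = 1 - j" if "j < 2" "j' < 2" for j j' :: nat using that by presburger
  then show ?thesis
    by (cases u; cases v) (auto simp: friendship_graph_def graph_join_def graph_copies_def complete_graph_def)
qed

lemma friendship_friendship_graph:
  "friendship (pverts (friendship_graph k)) (\<lambda>u v. (u, v) \<in> parcs (friendship_graph k)) (Inl 0) k"
proof -
  let ?G = "friendship_graph k"
  interpret pair_graph ?G by (rule pair_graph_friendship_graph)
  have nb0: "adj.nb (Inl 0) = pverts ?G - {Inl 0}"
    unfolding adj.nb_def by (auto simp: parcs_friendship_graph pverts_friendship_graph)
  have nb: "adj.nb (Inr (i, j)) = {Inl 0, Inr (i, 1 - j)}" if "i < k" "j < 2" for i j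
  proof -
    have "j \<noteq> 1 - j" using that by presburger
    then show ?thesis
      using that unfolding adj.nb_def by (auto simp: parcs_friendship_graph pverts_friendship_graph)
  qed
  have "adj.deg u = 2" if u: "u \<in> pverts ?G" "u \<noteq> Inl 0" for u
    using u by (auto simp: pverts_friendship_graph adj.deg_def nb)
  moreover have "card (pverts ?G) = 2 * k + 1"
    unfolding pverts_friendship_graph
    by (subst card_insert_disjoint) (auto simp: card_image card_cartesian_product)
  moreover have "Inl 0 \<in> pverts ?G" by (simp add: pverts_friendship_graph)
  ultimately show ?thesis using nb0 by unfold_locales
qed

lemma (in pair_graph) digraph_iso_friendship_graph:
  assumes fr: "friendship (pverts G) (\<lambda>u v. (u, v) \<in> parcs G) c k"
  shows "digraph_iso (with_proj G) (with_proj (friendship_graph k))"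
proof -
  interpret fr: friendship "pverts G" "\<lambda>u v. (u, v) \<in> parcs G" c k by (rule fr)
  let ?F = "friendship_graph k"
  interpret F: pair_graph ?F by (rule pair_graph_friendship_graph)
  note V = pverts_friendship_graph[of k]
  obtain g where g: "bij_betw g ({..<k} \<times> {..<2 :: nat}) (pverts G - {c})"
    and mate_g: "\<And>i. i < k \<Longrightarrow> fr.mate (g (i, 0)) = g (i, 1)"
    using fr.ex_pairing by blast
  have gV: "g (i, j) \<in> pverts G" "g (i, j) \<noteq> c" if "i < k" "j < 2" for i j
    using bij_betw_apply[OF g, of "(i, j)"] that by auto
  have g_eq: "g p = g q \<longleftrightarrow> p = q" if "p \<in> {..<k} \<times> {..<2}" "q \<in> {..<k} \<times> {..<2}" for p q
    using g that by (auto simp: bij_betw_def dest: inj_onD)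
  have mate_g': "fr.mate (g (i, j)) = g (i, 1 - j)" if "i < k" "j < 2" for i j
  proof (cases "j = 0")
    case True
    then show ?thesis using mate_g that by simp
  next
    case False
    then have "j = 1" using that by simp
    then show ?thesis using mate_g[OF that(1)] fr.mate(4) gV[of i 0] that by (metis diff_self_eq_0 pos2)
  qed
  \<comment> \<open>The centre goes to \<open>c\<close> and the copies of K_2 to the mate pairs
    numbered by \<open>g\<close>. A constant suffices on the left, where \<open>Inl 0\<close> is the
    only vertex.\<close>
  define f where "f = case_sum (\<lambda>_ :: nat. c) g"
  have f_simps: "f (Inl a) = c" "f (Inr p) = g p" for a p by (simp_all add: f_def)
  have "bij_betw f (pverts ?F) (pverts G)"
  proof -
    have "inj_on f (pverts ?F)"
      using gV g_eq by (force simp: V f_simps inj_on_def)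
    moreover have "f ` pverts ?F = insert c (g ` ({..<k} \<times> {..<2}))"
      by (simp add: V f_simps image_image)
    moreover have "g ` ({..<k} \<times> {..<2}) = pverts G - {c}" using g by (rule bij_betw_imp_surj_on)
    ultimately show ?thesis using fr.c(1) by (auto simp: bij_betw_def)
  qed
  then have inj: "inj_on f (pverts ?F)" and surj: "f ` pverts ?F = pverts G"
    by (auto simp: bij_betw_def)
  have adj: "(f u, f v) \<in> parcs G \<longleftrightarrow> (u, v) \<in> parcs ?F" if uv: "u \<in> pverts ?F" "v \<in> pverts ?F" for u v
  proof -
    have Fadj: "(u, v) \<in> parcs ?F \<longleftrightarrow> u \<noteq> v \<and>
      (u = Inl 0 \<or> v = Inl 0 \<or> (\<exists>i<k. \<exists>j<2. u = Inr (i, j) \<and> v = Inr (i, 1 - j)))"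
      using uv unfolding parcs_friendship_graph V by auto
    have fV: "f u \<in> pverts G" "f v \<in> pverts G" using uv surj by blast+
    have eq: "f u = f v \<longleftrightarrow> u = v" using inj uv by (auto dest: inj_onD)
    have fc: "f w = c \<longleftrightarrow> w = Inl 0" if w: "w \<in> pverts ?F" for w
    proof (cases w)
      case (Inl a)
      then show ?thesis using w by (auto simp: V f_simps)
    next
      case (Inr p)
      then obtain i j where "w = Inr (i, j)" "i < k" "j < 2" using w by (auto simp: V)
      then show ?thesis using gV(2)[of i j] by (simp add: f_simps)
    qed
    have "f v = fr.mate (f u) \<longleftrightarrow> (\<exists>i<k. \<exists>j<2. u = Inr (i, j) \<and> v = Inr (i, 1 - j))"
      if ne: "u \<noteq> Inl 0" "v \<noteq> Inl 0"
    proof -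
      obtain i j where u: "u = Inr (i, j)" "i < k" "j < 2" using uv(1) ne by (auto simp: V)
      obtain q where q: "v = Inr q" "q \<in> {..<k} \<times> {..<2}" using uv(2) ne by (auto simp: V)
      show ?thesis using u q by (auto simp: f_simps mate_g' g_eq)
    qed
    then show ?thesis unfolding Fadj fr.adj_iff[OF fV] eq fc[OF uv(1)] fc[OF uv(2)] by blast
  qed
  define h where "h = \<lparr> iso_verts = f, iso_arcs = map_prod f f, iso_head = snd, iso_tail = fst \<rparr>"
  have "inj_on (map_prod f f) (parcs ?F)"
    using inj F.in_arcsD1 F.in_arcsD2 by (auto simp: inj_on_def)
  then have "pre_digraph.digraph_isomorphism (with_proj ?F) h"
    using F.wf_digraph_axioms inj by (auto simp: pre_digraph.digraph_isomorphism_def h_def)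
  moreover have "with_proj G = app_iso h (with_proj ?F)"
  proof -
    have "map_prod f f ` parcs ?F = parcs G"
    proof (intro equalityI subsetI)
      fix e assume "e \<in> map_prod f f ` parcs ?F"
      then show "e \<in> parcs G" using adj F.in_arcsD1 F.in_arcsD2 by auto
    next
      fix e assume "e \<in> parcs G"
      then obtain x y where e: "e = (x, y)" "(x, y) \<in> parcs G" by (cases e) auto
      then have "x \<in> f ` pverts ?F" "y \<in> f ` pverts ?F"
        unfolding surj by (auto dest: in_arcsD1 in_arcsD2)
      then obtain u v where "u \<in> pverts ?F" "v \<in> pverts ?F" "x = f u" "y = f v" by blast
      then show "e \<in> map_prod f f ` parcs ?F" using adj e by (auto intro: rev_image_eqI)
    qed
    then show ?thesis using surj by (simp add: app_iso_def h_def with_proj_def)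
  qed
  ultimately have "digraph_iso (with_proj ?F) (with_proj G)" unfolding digraph_iso_def by blast
  then show ?thesis by (rule digraph_iso_swap[OF F.wf_digraph_axioms])
qed

section \<open>Long geodesics and twins detected by eigenvalues\<close>

lemma (in connected_pair_graph) graph_dist_le_2:
  assumes ev: "\<And>e. e \<in># dist_spectrum G \<Longrightarrow> \<exists>r. e = of_real r \<and> r \<ge> -3"
    and u: "u \<in> pverts G" and v: "v \<in> pverts G"
  shows "graph_dist G u v \<le> 2"
proof (rule ccontr)
  assume "\<not> ?thesis"
  then have "graph_dist G u v \<ge> 3" by simp
  then obtain a b c where V: "a \<in> pverts G" "b \<in> pverts G" "c \<in> pverts G" and
    d: "graph_dist G u a = 1" "graph_dist G u b = 2" "graph_dist G u c = 3"
    "graph_dist G a b = 1" "graph_dist G a c = 2" "graph_dist G b c = 1"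
    by (rule ex_geodesic_3[OF u v])
  have self: "graph_dist G w w = 0" if "w \<in> pverts G" for w
    using ex_awalk[OF that that] graph_dist_eq_0_iff by blast
  have ne: "u \<noteq> a" "u \<noteq> b" "u \<noteq> c" "a \<noteq> b" "a \<noteq> c" "b \<noteq> c"
    using d self u V by auto
  have d_sym: "graph_dist G a u = 1" "graph_dist G b u = 2" "graph_dist G c u = 3"
    "graph_dist G b a = 1" "graph_dist G c a = 2" "graph_dist G c b = 1"
    using d graph_dist_commute u V by metis+
  define x :: "'a \<Rightarrow> real" where
    "x w = (if w = u then 2 else if w = a then 1 else if w = b then -1 else if w = c then -2 else 0)" for w
  let ?S = "{u, a, b, c}"
  have S: "?S \<subseteq> pverts G" using u V by simp
  \<comment> \<open>Sums of terms that vanish with \<open>x\<close> reduce to the four vertices of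
    the geodesic.\<close>
  have sum: "(\<Sum>w\<in>pverts G. h w) = h u + h a + h b + h c"
    if "\<And>w. x w = 0 \<Longrightarrow> h w = 0" for h :: "'a \<Rightarrow> real"
  proof -
    have "(\<Sum>w\<in>pverts G. h w) = (\<Sum>w\<in>?S. h w)"
      using S pair_finite_verts that by (intro sum.mono_neutral_right) (auto simp: x_def)
    then show ?thesis using ne by simp
  qed
  have x: "x u = 2" "x a = 1" "x b = -1" "x c = -2" using ne by (auto simp: x_def)
  \<comment> \<open>The value -34 is below -3 times the squared norm 10, contrary to
    \<open>dist_form_ge\<close>.\<close>
  have "(\<Sum>w\<in>pverts G. \<Sum>z\<in>pverts G. graph_dist G w z * x w * x z) = -34"
    by (simp add: sum x d d_sym self u V)
  moreover have "(\<Sum>w\<in>pverts G. (x w)\<^sup>2) = 10"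
    by (simp add: sum x)
  ultimately show False using dist_form_ge[of 3 x] ev by simp
qed

text \<open>Twins have equal distances to every other vertex, so the difference of their indicators
  is an eigenvector. They are not adjacent, hence at distance 2, which makes the eigenvalue
  -2.\<close>

lemma (in pair_graph) minus_2_in_dist_spectrum:
  assumes diam: adj.diam_le_2
    and u: "u \<in> pverts G" and v: "v \<in> pverts G" and "u \<noteq> v" and nb: "adj.nb u = adj.nb v"
  shows "-2 \<in># dist_spectrum G"
proof -
  have dist: "graph_dist G a b = adj.diam2_dist a b" if "a \<in> pverts G" "b \<in> pverts G" for a b
    using diam that by (rule graph_dist_eq_if_diam_le_2)
  define x :: "'a \<Rightarrow> complex" where "x w = of_bool (u = w) - of_bool (v = w)" for w
  have "(\<Sum>b\<in>pverts G. of_nat (graph_dist G a b) * x b) = -2 * x a" if a: "a \<in> pverts G" for a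
  proof -
    have "(\<Sum>b\<in>pverts G. of_nat (graph_dist G a b) * x b)
        = (\<Sum>b\<in>pverts G. of_bool (u = b) * of_nat (adj.diam2_dist a b)
          - of_bool (v = b) * of_nat (adj.diam2_dist a b))"
      using a by (intro sum.cong) (simp_all add: dist x_def algebra_simps)
    also have "\<dots> = of_nat (adj.diam2_dist a u) - of_nat (adj.diam2_dist a v)"
      unfolding sum_subtractf adj.sum_delta[OF u] adj.sum_delta[OF v] ..
    also have "\<dots> = -2 * x a"
    proof -
      have "(a, u) \<in> parcs G \<longleftrightarrow> (a, v) \<in> parcs G"
        using nb adj.nb_commute adj.mem_nb by metis
      moreover have "(u, v) \<notin> parcs G" "(v, u) \<notin> parcs G"
        using nb adj.irrefl adj.mem_nb by metis+
      ultimately show ?thesis using \<open>u \<noteq> v\<close> by (auto simp: adj.diam2_dist_def x_def)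
    qed
    finally show ?thesis .
  qed
  moreover have "x u \<noteq> 0" using \<open>u \<noteq> v\<close> by (simp add: x_def)
  ultimately show ?thesis unfolding mem_dist_spectrum_iff using u by blast
qed

section \<open>Determination of friendship graphs by their distance spectrum\<close>

theorem corollary4p4:
  fixes k :: nat and H :: "'a pair_pre_digraph"
  assumes "k \<ge> 1"
    and "pair_graph H"
    and "connected (with_proj H)"
    and "dist_spectrum H = dist_spectrum (friendship_graph k)"
  shows "digraph_iso (with_proj H) (with_proj (friendship_graph k))"
proof -
  let ?F = "friendship_graph k"
  interpret H: connected_pair_graph H
    using assms(2,3) by (simp add: connected_pair_graph_def connected_pair_graph_axioms_def)
  interpret F: pair_graph ?F by (rule pair_graph_friendship_graph)
  interpret fr: friendship "pverts ?F" "\<lambda>u v. (u, v) \<in> parcs ?F" "Inl 0" k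
    by (rule friendship_friendship_graph)
  have ev: "\<exists>r. e = of_real r \<and> r \<ge> -3 \<and> r \<noteq> -2" if "e \<in># dist_spectrum H" for e
    using F.dist_spectrum_friendship[OF friendship_friendship_graph assms(1)] that assms(4) by simp
  have card: "card (pverts H) = 2 * k + 1"
    using assms(4) H.size_dist_spectrum F.size_dist_spectrum fr.card_V by simp
  have diam: H.adj.diam_le_2
    unfolding H.adj.diam_le_2_def
  proof (intro ballI impI)
    fix u v assume uv: "u \<in> pverts H" "v \<in> pverts H" "u \<noteq> v" "(u, v) \<notin> parcs H"
    obtain p where p: "H.awalk u p v" using H.ex_awalk uv by blast
    have "graph_dist H u v \<le> 2" using ev uv by (intro H.graph_dist_le_2) blast+
    moreover have "graph_dist H u v \<noteq> 0" "graph_dist H u v \<noteq> 1"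
      using H.graph_dist_eq_0_iff[OF p] H.graph_dist_eq_1_iff[OF p] uv by auto
    ultimately have "graph_dist H u v = 2" by simp
    then show "H.adj.nb u \<inter> H.adj.nb v \<noteq> {}" by (rule H.common_nb_if_graph_dist_2[OF p])
  qed
  have twins: "H.adj.nb u \<noteq> H.adj.nb v" if uv: "u \<in> pverts H" "v \<in> pverts H" "u \<noteq> v" for u v
  proof
    assume "H.adj.nb u = H.adj.nb v"
    then have "-2 \<in># dist_spectrum H" using diam uv by (intro H.minus_2_in_dist_spectrum)
    from ev[OF this] obtain r :: real where "-2 = complex_of_real r" "r \<noteq> -2" by blast
    then show False by (metis of_real_eq_iff of_real_minus of_real_numeral)
  qed
  \<comment> \<open>The orders agree, so equal second moments leave only the degree sums to
    compare.\<close>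
  have "of_int (4 * (int (card (pverts H)))\<^sup>2 - 4 * int (card (pverts H)) - 3 * int (\<Sum>u\<in>pverts H. H.adj.deg u))
    = (of_int (4 * (int (card (pverts ?F)))\<^sup>2 - 4 * int (card (pverts ?F)) - 3 * int (\<Sum>u\<in>pverts ?F. F.adj.deg u)) :: complex)"
    using H.dist_spectrum_moment_2_diam2[OF diam] F.dist_spectrum_moment_2_diam2[OF fr.diam_le_2] assms(4)
    by simp
  then have sum: "(\<Sum>u\<in>pverts H. H.adj.deg u) = 6 * k"
    unfolding of_int_eq_iff card fr.card_V fr.sum_deg by linarith
  define n where "n = int (2 * k + 1)"
  \<comment> \<open>With equal orders and degree sums, the third moments compare only six times the
    sum of squared degrees minus \<open>triangles\<close>; for the friendship graph this is 6(4k^2 +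
    8k) - 6k.\<close>
  have "of_int (8 * n ^ 3 - 24 * n\<^sup>2 + 16 * n + (18 - 12 * n) * int (6 * k)
        + 6 * int (\<Sum>u\<in>pverts H. (H.adj.deg u)\<^sup>2) - int H.adj.triangles)
      = (of_int (8 * n ^ 3 - 24 * n\<^sup>2 + 16 * n + (18 - 12 * n) * int (6 * k)
        + 6 * int (4 * k\<^sup>2 + 8 * k) - int (6 * k)) :: complex)"
    using H.dist_spectrum_moment_3_diam2[OF diam] F.dist_spectrum_moment_3_diam2[OF fr.diam_le_2] assms(4)
    unfolding card fr.card_V sum fr.sum_deg fr.sum_deg_2 fr.triangles_eq n_def by (simp only:)
  then have "int (6 * (\<Sum>u\<in>pverts H. (H.adj.deg u)\<^sup>2)) = int (H.adj.triangles + 24 * k\<^sup>2 + 42 * k)"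
    unfolding of_int_eq_iff by (simp add: algebra_simps)
  then have moment: "6 * (\<Sum>u\<in>pverts H. (H.adj.deg u)\<^sup>2) = H.adj.triangles + 24 * k\<^sup>2 + 42 * k"
    unfolding of_nat_eq_iff .
  obtain c where c: "c \<in> pverts H" "H.adj.nb c = pverts H - {c}"
    using H.adj.ex_dominating[OF card assms(1) sum moment diam twins] by blast
  have "friendship (pverts H) (\<lambda>u v. (u, v) \<in> parcs H) c k"
    using c card H.adj.all_deg_2_if_dominating[OF card sum moment c] by unfold_locales
  then show ?thesis by (rule H.digraph_iso_friendship_graph)
qed

end
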